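(* Let $m,n\in\mathbb N$, let $\mathbf d=(d_j)_{j=1}^m\in\mathbb N^m$ with $d_1\ge\dots\ge d_m$, and let $\alpha=(\alpha_i)_{i=1}^n\in\mathbb R_{>0}^n$ with $\alpha_1\ge\dots\ge\alpha_n$, such that $d_1\le n$. Let $\mathcal M^{\rm op}=\{\mu_j^{\rm op}\}_{j=1}^m$ be as defined in the context, and let $\Phi^{\rm op}=(\mathcal F_j^{\rm op})_{j=1}^m\in\mathcal D(\alpha,\mathbf d)$ be an $(\alpha,\mathbf d)$-design such that $\mathcal M_{\Phi^{\rm op}}=\mathcal M^{\rm op}$. 1. For every convex function $\varphi:[0,\infty)\to[0,\infty)$, $$\mathrm P_\varphi(\Phi^{\rm op})\le \mathrm P_\varphi(\Phi)\quad\text{for every }\Phi\in\mathcal D(\alpha,\mathbf d).$$ 2. Moreover, if $\Phi=(\mathcal F_j)_{j=1}^m\in\mathcal D(\alpha,\mathbf d)$ is such that there exists a strictly convex function $\varphi:[0,\infty)\to[0,\infty)$ for which $\Phi$ is a global minimizer of $\mathrm P_\varphi$ on $\mathcal D(\alpha,\mathbf d)$ (i.e. $\mathrm P_\varphi(\Phi)=\mathrm P_\varphi(\Phi^{\rm op})$), then $\Lambda_\Phi=\Lambda_{\Phi^{\rm op}}$ and $\mathcal M_\Phi=\mathcal M^{\rm op}$, so that $\lambda(S_{\mathcal F_j})=\mu_j^{\rm op}\in\mathbb R_{>0}^{d_j}$ for every $j\in\{1,\dots,m\}$; in particular, $\mathcal F_j$ is a frame for $\mathbb C^{d_j}$ for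 every $j\in\{1,\dots,m\}$.
   Context: Designs: an $(\alpha,\mathbf d)$-design is an $m$-tuple $\Phi=(\mathcal F_j)_{j=1}^m$ where each $\mathcal F_j=\{f_{ij}\}_{i=1}^n$ is a sequence of $n$ vectors in $\mathbb C^{d_j}$ (not necessarily a frame) and $\sum_{j=1}^m\|f_{ij}\|^2=\alpha_i$ for every $i\in\{1,\dots,n\}$. The set of all $(\alpha,\mathbf d)$-designs is denoted $\mathcal D(\alpha,\mathbf d)$. Frame operator: for a sequence $\mathcal F=\{f_i\}_{i=1}^n$ in $\mathbb C^k$, $S_{\mathcal F}f=\sum_{i=1}^n\langle f,f_i\rangle f_i$ for $f\in\mathbb C^k$; $\mathcal F$ is a frame for $\mathbb C^k$ if it spans $\mathbb C^k$ (equivalently, $S_{\mathcal F}$ is invertible). For a selfadjoint $A\in\mathcal M_k(\mathbb C)$, $\lambda(A)=(\lambda_i(A))_{i=1}^k\in\mathbb R^k$ is the vector of eigenvalues counted with multiplicity in non-increasing order. For $\Phi=(\mathcal F_j)_{j=1}^m\in\mathcal D(\alpha,\mathbf d)$ put $$\mathcal M_\Phi=\{\lambda(S_{\mathcal F_j})\}_{j=1}^m,\qquad \Lambda_\Phi=(\lambda(S_{\mathcal F_1}),\dots,\lambda(S_{\mathcal F_m}))\in\mathbb R_{\ge0}^{d},\quad d=\sum_{j=1}^m d_j$$ (concatenation, not reordered). Joint potential: for a convex $\varphi:[0,\infty)\to[0,\infty)$ and $\Phi=(\mathcal F_j)_{j=1}^m\in\mathcal D(\alpha,\mathbf d)$,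 $$\mathrm P_\varphi(\Phi)=\sum_{j=1}^m\operatorname{tr}\varphi(S_{\mathcal F_j})=\sum_{j=1}^m\sum_{i=1}^{d_j}\varphi(\lambda_i(S_{\mathcal F_j})).$$ Majorization: for $x,y\in\mathbb R^k$, $y\succ x$ means $\sum_{i=1}^{\ell}x_i^\downarrow\le\sum_{i=1}^{\ell}y_i^\downarrow$ for $1\le\ell\le k$ with equality for $\ell=k$, where $x^\downarrow$ is the non-increasing rearrangement. For non-negative vectors of different lengths, the shorter one is first padded with zeros. Definition of $\mathcal M^{\rm op}$: let $h_i=\#\{j\in\{1,\dots,m\}:d_j\ge i\}$ for $1\le i\le d_1$, and for $1\le s\le t\le d_1$ let $$P_{s,t}=\frac{\sum_{i=s}^t\alpha_i}{\sum_{i=s}^t h_i},\qquad Q_t=\frac{\sum_{i=t}^n\alpha_i}{\sum_{i=t}^{d_1}h_i}.$$ There exist (this is a known fact, for all such $\alpha,\mathbf d$) $p\in\{1,\dots,d_1\}$ and integers $0=g_0<g_1<\dots<g_p=d_1$ such that, with $\gamma_i=P_{g_{i-1}+1,g_i}$ for $1\le i\le p-1$ and $\gamma_p=Q_{g_{p-1}+1}$: (i) $\gamma_1>\dots>\gamma_p>0$; (ii) $(\gamma_i h_k)_{k=g_{i-1}+1}^{g_i}\succ(\alpha_k)_{k=g_{i-1}+1}^{g_i}$ for $1\le i\le p-1$, and $(\gamma_p h_k)_{k=g_{p-1}+1}^{d_1}\succ(\alpha_k)_{k=g_{p-1}+1}^{n}$. Fix any such choice. Then $\mu_1^{\rm op}=(\mu_{i1}^{\rm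 op})_{i=1}^{d_1}\in\mathbb R_{>0}^{d_1}$ is the vector with $\mu_{i1}^{\rm op}=\gamma_k$ whenever $g_{k-1}+1\le i\le g_k$; for $j>1$, $\mu_j^{\rm op}=(\mu_{i1}^{\rm op})_{i=1}^{d_j}$ is its truncation to the first $d_j$ entries; and $\mathcal M^{\rm op}=\{\mu_j^{\rm op}\}_{j=1}^m$. It is a known fact that a design $\Phi^{\rm op}\in\mathcal D(\alpha,\mathbf d)$ with $\mathcal M_{\Phi^{\rm op}}=\mathcal M^{\rm op}$ exists. *)

theory Defs
  imports
    "HOL-Analysis.Convex"
    "Jordan_Normal_Form.Char_Poly"
    "Jordan_Normal_Form.VS_Connect"
begin

text \<open>
  All sequences of the source are indexed from 1.  The parameters \<open>d\<close>, \<open>\<alpha>\<close>, \<open>g\<close>, \<open>h\<close>, \<open>\<gamma>\<close> are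
  functions on \<open>nat\<close> of which only the values at the indices in question matter (values at
  other indices are never inspected); a sequence of \<open>n\<close> vectors is a function \<open>F\<close> of which only
  \<open>F 1, \<dots>, F n\<close> matter, and a design is a function \<open>\<Phi>\<close> with \<open>\<Phi> j i\<close> the vector \<open>f\<^sub>i\<^sub>j\<close>, for
  \<open>1 \<le> j \<le> m\<close> and \<open>1 \<le> i \<le> n\<close>.  Real vectors that are compared with one another are lists.
\<close>

section \<open>Strict convexity\<close>

definition strictly_convex_on :: "'a::real_vector set \<Rightarrow> ('a \<Rightarrow> real) \<Rightarrow> bool" where
  "strictly_convex_on S f \<longleftrightarrow> convex S \<and>
    (\<forall>x\<in>S. \<forall>y\<in>S. \<forall>u>0. \<forall>v>0. x \<noteq> y \<longrightarrow> u + v = 1 \<longrightarrow>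
      f (u *\<^sub>R x + v *\<^sub>R y) < u * f x + v * f y)"

section \<open>Majorization\<close>

definition decr :: "real list \<Rightarrow> real list" where
  "decr xs = rev (sort xs)"

definition pad :: "nat \<Rightarrow> real list \<Rightarrow> real list" where
  "pad N xs = xs @ replicate (N - length xs) 0"

text \<open>\<open>majorizes y x\<close> stands for \<open>y \<succ> x\<close>.\<close>

definition majorizes :: "real list \<Rightarrow> real list \<Rightarrow> bool" where
  "majorizes y x \<longleftrightarrow>
    (let N = max (length x) (length y); x' = decr (pad N x); y' = decr (pad N y) in
      (\<forall>l\<in>{1..N}. sum_list (take l x') \<le> sum_list (take l y')) \<and> sum_list x' = sum_list y')"

section \<open>Frame operators and their spectra\<close>

definition cvec_norm :: "complex vec \<Rightarrow> real" where
  "cvec_norm v = sqrt (Re (v \<bullet>c v))"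

definition frame_operator :: "nat \<Rightarrow> nat \<Rightarrow> (nat \<Rightarrow> complex vec) \<Rightarrow> complex vec \<Rightarrow> complex vec" where
  "frame_operator k n F f = finsum_vec TYPE(complex) k (\<lambda>i. (f \<bullet>c F i) \<cdot>\<^sub>v F i) {1..n}"

text \<open>The matrix of the frame operator in the standard basis.\<close>

definition frame_mat :: "nat \<Rightarrow> nat \<Rightarrow> (nat \<Rightarrow> complex vec) \<Rightarrow> complex mat" where
  "frame_mat k n F = mat k k (\<lambda>(r, s). frame_operator k n F (unit_vec k s) $ r)"

definition is_frame :: "nat \<Rightarrow> nat \<Rightarrow> (nat \<Rightarrow> complex vec) \<Rightarrow> bool" where
  "is_frame k n F \<longleftrightarrow>
    LinearCombinations.module.span class_ring (module_vec TYPE(complex) k) (F ` {1..n})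
      = carrier_vec k"

text \<open>
  For selfadjoint \<open>A\<close> the roots of the characteristic polynomial are real and their algebraic
  multiplicities agree with the geometric ones, so this is the list of eigenvalues, counted with
  multiplicity, in non-increasing order.  The value has no meaning for other matrices.
\<close>

definition spec_list :: "complex mat \<Rightarrow> real list" where
  "spec_list A = rev (sorted_list_of_multiset (image_mset Re (proots (char_poly A))))"

section \<open>Designs and the joint potential\<close>

definition designs :: "nat \<Rightarrow> nat \<Rightarrow> (nat \<Rightarrow> nat) \<Rightarrow> (nat \<Rightarrow> real) \<Rightarrow> (nat \<Rightarrow> nat \<Rightarrow> complex vec) set" where
  "designs m n d \<alpha> =
    {\<Phi>. (\<forall>j\<in>{1..m}. \<forall>i\<in>{1..n}. \<Phi> j i \<in> carrier_vec (d j)) \<and>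
         (\<forall>i\<in>{1..n}. (\<Sum>j=1..m. (cvec_norm (\<Phi> j i))\<^sup>2) = \<alpha> i)}"

definition M_design :: "nat \<Rightarrow> nat \<Rightarrow> (nat \<Rightarrow> nat) \<Rightarrow> (nat \<Rightarrow> nat \<Rightarrow> complex vec) \<Rightarrow> real list list" where
  "M_design m n d \<Phi> = map (\<lambda>j. spec_list (frame_mat (d j) n (\<Phi> j))) [1..<Suc m]"

definition Lambda_design :: "nat \<Rightarrow> nat \<Rightarrow> (nat \<Rightarrow> nat) \<Rightarrow> (nat \<Rightarrow> nat \<Rightarrow> complex vec) \<Rightarrow> real list" where
  "Lambda_design m n d \<Phi> = concat (M_design m n d \<Phi>)"

definition joint_potential ::
  "nat \<Rightarrow> nat \<Rightarrow> (nat \<Rightarrow> nat) \<Rightarrow> (real \<Rightarrow> real) \<Rightarrow> (nat \<Rightarrow> nat \<Rightarrow> complex vec) \<Rightarrow> real" where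
  "joint_potential m n d \<phi> \<Phi> =
    (\<Sum>j=1..m. \<Sum>i<d j. \<phi> (spec_list (frame_mat (d j) n (\<Phi> j)) ! i))"

section \<open>The optimal spectra\<close>

definition h_seq :: "nat \<Rightarrow> (nat \<Rightarrow> nat) \<Rightarrow> nat \<Rightarrow> nat" where
  "h_seq m d i = card {j\<in>{1..m}. d j \<ge> i}"

definition P_avg :: "nat \<Rightarrow> (nat \<Rightarrow> nat) \<Rightarrow> (nat \<Rightarrow> real) \<Rightarrow> nat \<Rightarrow> nat \<Rightarrow> real" where
  "P_avg m d \<alpha> s t = (\<Sum>i=s..t. \<alpha> i) / (\<Sum>i=s..t. real (h_seq m d i))"

definition Q_avg :: "nat \<Rightarrow> nat \<Rightarrow> (nat \<Rightarrow> nat) \<Rightarrow> (nat \<Rightarrow> real) \<Rightarrow> nat \<Rightarrow> real" where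
  "Q_avg m n d \<alpha> t = (\<Sum>i=t..n. \<alpha> i) / (\<Sum>i=t..d 1. real (h_seq m d i))"

definition gamma_op ::
  "nat \<Rightarrow> nat \<Rightarrow> (nat \<Rightarrow> nat) \<Rightarrow> (nat \<Rightarrow> real) \<Rightarrow> nat \<Rightarrow> (nat \<Rightarrow> nat) \<Rightarrow> nat \<Rightarrow> real" where
  "gamma_op m n d \<alpha> p g i =
    (if i < p then P_avg m d \<alpha> (g (i - 1) + 1) (g i) else Q_avg m n d \<alpha> (g (p - 1) + 1))"

text \<open>\<open>admissible_cuts m n d \<alpha> p g\<close>: the indices \<open>0 = g\<^sub>0 < \<dots> < g\<^sub>p = d\<^sub>1\<close> are a possible
  choice for the construction of the optimal spectra.\<close>

definition admissible_cuts ::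
  "nat \<Rightarrow> nat \<Rightarrow> (nat \<Rightarrow> nat) \<Rightarrow> (nat \<Rightarrow> real) \<Rightarrow> nat \<Rightarrow> (nat \<Rightarrow> nat) \<Rightarrow> bool" where
  "admissible_cuts m n d \<alpha> p g \<longleftrightarrow>
    p \<in> {1..d 1} \<and> g 0 = 0 \<and> g p = d 1 \<and> strict_mono_on {0..p} g \<and>
    strict_antimono_on {1..p} (gamma_op m n d \<alpha> p g) \<and> gamma_op m n d \<alpha> p g p > 0 \<and>
    (\<forall>i\<in>{1..p - 1}. majorizes
      (map (\<lambda>k. gamma_op m n d \<alpha> p g i * real (h_seq m d k)) [g (i - 1) + 1..<Suc (g i)])
      (map \<alpha> [g (i - 1) + 1..<Suc (g i)])) \<and>
    majorizes
      (map (\<lambda>k. gamma_op m n d \<alpha> p g p * real (h_seq m d k)) [g (p - 1) + 1..<Suc (d 1)])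
      (map \<alpha> [g (p - 1) + 1..<Suc n])"

text \<open>The entry \<open>\<mu>\<^sub>i\<^sub>1\<close>.\<close>

definition mu_entry ::
  "nat \<Rightarrow> nat \<Rightarrow> (nat \<Rightarrow> nat) \<Rightarrow> (nat \<Rightarrow> real) \<Rightarrow> nat \<Rightarrow> (nat \<Rightarrow> nat) \<Rightarrow> nat \<Rightarrow> real" where
  "mu_entry m n d \<alpha> p g i =
    gamma_op m n d \<alpha> p g (THE k. k \<in> {1..p} \<and> g (k - 1) + 1 \<le> i \<and> i \<le> g k)"

definition mu_op ::
  "nat \<Rightarrow> nat \<Rightarrow> (nat \<Rightarrow> nat) \<Rightarrow> (nat \<Rightarrow> real) \<Rightarrow> nat \<Rightarrow> (nat \<Rightarrow> nat) \<Rightarrow> nat \<Rightarrow> real list" where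
  "mu_op m n d \<alpha> p g j = map (mu_entry m n d \<alpha> p g) [1..<Suc (d j)]"

definition M_op ::
  "nat \<Rightarrow> nat \<Rightarrow> (nat \<Rightarrow> nat) \<Rightarrow> (nat \<Rightarrow> real) \<Rightarrow> nat \<Rightarrow> (nat \<Rightarrow> nat) \<Rightarrow> real list list" where
  "M_op m n d \<alpha> p g = map (mu_op m n d \<alpha> p g) [1..<Suc m]"

section \<open>Checks of the encodings\<close>

lemma frame_mat_mult_vec:
  assumes F: "\<And>i. i \<in> {1..n} \<Longrightarrow> F i \<in> carrier_vec k" and f: "f \<in> carrier_vec k"
  shows "frame_mat k n F *\<^sub>v f = frame_operator k n F f"
proof -
  have car: "(\<lambda>i. (v \<bullet>c F i) \<cdot>\<^sub>v F i) \<in> {1..n} \<rightarrow> carrier_vec k" for v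
    using F by auto
  have ent: "frame_operator k n F v $ r = (\<Sum>i=1..n. (v \<bullet>c F i) * F i $ r)"
    if "r < k" for v r
  proof -
    have "frame_operator k n F v $ r = (\<Sum>i=1..n. ((v \<bullet>c F i) \<cdot>\<^sub>v F i) $ r)"
      unfolding frame_operator_def using car that by (intro index_finsum_vec) auto
    also have "\<dots> = (\<Sum>i=1..n. (v \<bullet>c F i) * F i $ r)"
    proof (intro sum.cong refl)
      fix i assume "i \<in> {1..n}"
      hence "r < dim_vec (F i)" using F[of i] that by auto
      thus "((v \<bullet>c F i) \<cdot>\<^sub>v F i) $ r = (v \<bullet>c F i) * F i $ r" by simp
    qed
    finally show ?thesis .
  qed
  have un: "unit_vec k s \<bullet>c F i = conjugate (F i $ s)" if "s < k" "i \<in> {1..n}" for s i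
    using F[OF that(2)] that(1) by (subst scalar_prod_left_unit) auto
  show ?thesis
  proof (rule eq_vecI)
    show dim: "dim_vec (frame_mat k n F *\<^sub>v f) = dim_vec (frame_operator k n F f)"
      using finsum_vec_closed[OF car[of f]] by (auto simp: frame_mat_def frame_operator_def)
    fix r assume "r < dim_vec (frame_operator k n F f)"
    hence r: "r < k" using dim by (simp add: frame_mat_def)
    have "(frame_mat k n F *\<^sub>v f) $ r = (\<Sum>s<k. frame_operator k n F (unit_vec k s) $ r * f $ s)"
      using r f by (auto simp: frame_mat_def scalar_prod_def atLeast0LessThan intro!: sum.cong)
    also have "\<dots> = (\<Sum>s<k. \<Sum>i=1..n. f $ s * cnj (F i $ s) * F i $ r)"
      using r by (intro sum.cong refl) (auto simp: ent un sum_distrib_right intro!: sum.cong)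
    also have "\<dots> = (\<Sum>i=1..n. (\<Sum>s<k. f $ s * cnj (F i $ s)) * F i $ r)"
      by (subst sum.swap) (simp add: sum_distrib_right)
    also have "\<dots> = (\<Sum>i=1..n. (f \<bullet>c F i) * F i $ r)"
    proof (intro sum.cong refl)
      fix i assume "i \<in> {1..n}"
      hence "dim_vec (F i) = k" using F[of i] by auto
      thus "(\<Sum>s<k. f $ s * cnj (F i $ s)) * F i $ r = (f \<bullet>c F i) * F i $ r"
        by (simp add: scalar_prod_def atLeast0LessThan)
    qed
    also have "\<dots> = frame_operator k n F f $ r" using r by (simp add: ent)
    finally show "(frame_mat k n F *\<^sub>v f) $ r = frame_operator k n F f $ r" .
  qed
qed

lemma length_spec_list:
  assumes "A \<in> carrier_mat k k"
  shows "length (spec_list A) = k"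
proof -
  obtain as :: "complex list" where "char_poly A = (\<Prod>a\<leftarrow>as. [:- a, 1:])" and "length as = k"
    using char_poly_factorized[OF assms] by blast
  moreover have "proots (\<Prod>a\<leftarrow>as. [:- a, 1:]) = mset as" for as :: "complex list"
  proof (induction as)
    case (Cons a as)
    have "(\<Prod>a\<leftarrow>as. [:- a, 1:]) \<noteq> 0" by (auto simp: prod_list_zero_iff)
    hence "proots ([:- a, 1:] * (\<Prod>a\<leftarrow>as. [:- a, 1:])) = {#a#} + mset as"
      using Cons.IH by (subst proots_mult) auto
    thus ?case by simp
  qed simp
  ultimately have "size (proots (char_poly A)) = k" by (metis size_mset)
  moreover have "length (spec_list A) = size (mset (spec_list A))" by simp
  moreover have "mset (spec_list A) = image_mset Re (proots (char_poly A))"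
    by (simp add: spec_list_def)
  ultimately show ?thesis by (simp only: size_image_mset)
qed

lemma mu_entry_eq:
  assumes "admissible_cuts m n d \<alpha> p g" and k: "k \<in> {1..p}" and i: "g (k - 1) + 1 \<le> i" "i \<le> g k"
  shows "mu_entry m n d \<alpha> p g i = gamma_op m n d \<alpha> p g k"
proof -
  have mono: "g a \<le> g b" if "a \<le> b" "b \<le> p" for a b
    using assms(1) that strict_mono_on_leD[of "{0..p}" g a b] by (auto simp: admissible_cuts_def)
  have "l = k" if l: "l \<in> {1..p}" "g (l - 1) + 1 \<le> i" "i \<le> g l" for l
  proof (rule ccontr)
    assume "l \<noteq> k"
    then consider "l \<le> k - 1" | "k \<le> l - 1" by linarith
    thus False
    proof cases
      case 1
      hence "g l \<le> g (k - 1)" using k by (intro mono) auto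
      with l i show False by simp
    next
      case 2
      hence "g k \<le> g (l - 1)" using l by (intro mono) auto
      with l i show False by simp
    qed
  qed
  hence "(THE k. k \<in> {1..p} \<and> g (k - 1) + 1 \<le> i \<and> i \<le> g k) = k"
    using k i by (intro the_equality conjI) blast+
  thus ?thesis by (simp add: mu_entry_def)
qed

end

theory Submission
  imports Defs "Jordan_Normal_Form.Schur_Decomposition"
begin

text \<open>
  Write \<open>\<lambda>\<^sub>i\<^sub>j\<close> for the \<open>i\<close>-th eigenvalue of the \<open>j\<close>-th frame operator of a design, \<open>\<mu>\<^sub>i\<close> for the
  optimal entries, and \<open>h\<^sub>i\<close> for the number of components of dimension at least \<open>i\<close>.  Only one fact
  about designs enters: the sum of the squared norms of any \<open>t\<close> vectors is at most the sum of the \<open>t\<close>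
  largest eigenvalues of their frame operator (\<open>frame_spectrum_dominates\<close>).  Added up over the
  components it says that \<open>b\<^sub>i = \<Sum>\<^sub>j \<lambda>\<^sub>i\<^sub>j\<close> satisfies \<open>\<Sum>\<^sub>i\<^sub>\<le>\<^sub>t b\<^sub>i \<ge> \<Sum>\<^sub>i\<^sub>\<le>\<^sub>t \<alpha>\<^sub>i\<close>, and the two totals
  agree (\<open>design_spectra_dominate\<close>).

  A convex function lies above its supporting line with slope \<open>\<sigma>(\<mu>\<^sub>i)\<close> at \<open>\<mu>\<^sub>i > 0\<close>.  Evaluating at
  \<open>\<lambda>\<^sub>i\<^sub>j\<close> and adding gives
  \<open>P\<^sub>\<phi>(\<Phi>) \<ge> \<Sum>\<^sub>i h\<^sub>i \<phi>(\<mu>\<^sub>i) + \<Sum>\<^sub>i \<sigma>(\<mu>\<^sub>i) (b\<^sub>i - h\<^sub>i \<mu>\<^sub>i)\<close>,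
  where the first sum is the potential of the optimal design.  The second one is nonnegative
  (\<open>first_order_term_nonneg\<close>): the slopes are constant on each block of indices and decrease from
  block to block, because \<open>\<mu>\<close> does and slopes of supporting lines are monotone; at the end of a block
  the values \<open>\<gamma>\<close>, which are averages over the blocks, make the partial sum of \<open>h\<^sub>i \<mu>\<^sub>i\<close> equal to that
  of \<open>\<alpha>\<^sub>i\<close>; so Abel summation over the blocks leaves only nonnegative terms.

  If \<open>\<phi>\<close> is strictly convex, then a point of its graph on a supporting line can only be the point of
  contact.  Equality of the potentials therefore forces \<open>\<lambda>\<^sub>i\<^sub>j = \<mu>\<^sub>i\<close> for all \<open>i\<close> and \<open>j\<close>, and since
  these are positive, the frame operators are invertible.

  The inequality for eigenvalues is proved in an orthonormal eigenbasis \<open>u\<^sub>1, u\<^sub>2, \<dots>\<close> of the frame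
  operator.  The rows \<open>(\<langle>f\<^sub>i, u\<^sub>r\<rangle>)\<^sub>i\<close> are orthogonal with squared norms \<open>\<lambda>\<^sub>r\<close>, so Bessel's inequality
  bounds, for every single \<open>i\<close>, the sum over \<open>r\<close> of \<open>\<bar>\<langle>f\<^sub>i, u\<^sub>r\<rangle>\<bar>\<^sup>2 / \<lambda>\<^sub>r\<close> by 1.  Hence \<open>t\<close> of the
  vectors distribute over the eigenvalues with weights in \<open>[0, 1]\<close> of total at most \<open>t\<close>.  The
  eigenbasis itself comes from a unitary triangularization (\<open>unitary_schur\<close>), since a triangular
  Hermitian matrix is diagonal.
\<close>

section \<open>Unitary triangularization\<close>

lemma cscalar_self: "w \<bullet>c w = of_real (\<Sum>i<dim_vec w. (cmod (w $ i))\<^sup>2)" for w :: "complex vec"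
  by (auto simp: scalar_prod_def atLeast0LessThan complex_norm_square[symmetric] intro!: sum.cong)

text \<open>Complete \<open>v\<close> to a basis, orthogonalize by Gram-Schmidt, which keeps the first vector, and normalize.\<close>

lemma orthonormal_basis_extending:
  fixes v :: "complex vec"
  assumes v: "v \<in> carrier_vec n" "v \<noteq> 0\<^sub>v n"
  obtains ws c where "set ws \<subseteq> carrier_vec n" "corthogonal ws" "length ws = n"
    "\<And>w. w \<in> set ws \<Longrightarrow> w \<bullet>c w = 1" "hd ws = c \<cdot>\<^sub>v v" "c \<noteq> 0"
proof -
  interpret cof_vec_space n "TYPE(complex)" .
  define b where "b = basis_completion v"
  from basis_completion[OF v, folded b_def]
  have dist_b: "distinct b" and indep: "\<not> lin_dep (set b)" and b: "set b \<subseteq> carrier_vec n"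
    and hdb: "hd b = v" and len_b: "length b = n" by auto
  have n: "n \<noteq> 0" using v by auto
  then obtain vs where bv: "b = v # vs" using hdb len_b by (cases b) auto
  define us where "us = gram_schmidt n b"
  from gram_schmidt_result[OF b dist_b indep refl, folded us_def]
  have us: "set us \<subseteq> carrier_vec n" "corthogonal us" "length us = n" by (auto simp: len_b)
  have hdus: "hd us = v" unfolding us_def using gram_schmidt_hd[OF v(1), of vs] bv by simp
  define N where "N u = (complex_of_real (1 / sqrt (Re (u \<bullet>c u))))" for u
  define ws where "ws = map (\<lambda>u. N u \<cdot>\<^sub>v u) us"
  have inner: "(N u \<cdot>\<^sub>v u) \<bullet>c (N w \<cdot>\<^sub>v w) = N u * N w * (u \<bullet>c w)"
    if "u \<in> carrier_vec n" "w \<in> carrier_vec n" for u w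
    using that by (simp add: N_def conjugate_smult_vec)
  have pos: "Re (u \<bullet>c u) > 0 \<and> u \<bullet>c u = of_real (Re (u \<bullet>c u))" if u: "u \<in> set us" for u
  proof -
    obtain i where "i < length us" "u = us ! i" using u by (auto simp: in_set_conv_nth)
    hence "u \<bullet>c u \<noteq> 0" using corthogonalD[OF us(2), of i i] by auto
    thus ?thesis unfolding cscalar_self
      by (smt (verit, del_insts) Re_complex_of_real of_real_0 sum_nonneg zero_le_power2)
  qed
  have car: "u \<in> carrier_vec n" if "u \<in> set us" for u using us that by auto
  show thesis
  proof (rule that)
    show "set ws \<subseteq> carrier_vec n" "length ws = n" using us by (auto simp: ws_def)
    show "corthogonal ws"
    proof (rule corthogonalI)
      fix i j assume ij: "i < length ws" "j < length ws"
      hence m: "us ! i \<in> set us" "us ! j \<in> set us" by (auto simp: ws_def)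
      have nz: "N (us ! i) \<noteq> 0" "N (us ! j) \<noteq> 0" using pos[OF m(1)] pos[OF m(2)] by (auto simp: N_def)
      have "ws ! i \<bullet>c ws ! j = N (us ! i) * N (us ! j) * (us ! i \<bullet>c us ! j)"
        using ij inner[OF car[OF m(1)] car[OF m(2)]] by (simp add: ws_def)
      thus "(ws ! i \<bullet>c ws ! j = 0) = (i \<noteq> j)"
        using nz corthogonalD[OF us(2), of i j] ij by (simp add: ws_def)
    qed
    show "hd ws = N v \<cdot>\<^sub>v v" using hdus us(3) n by (cases us) (auto simp: ws_def)
    have "v \<in> set us" using hdus us(3) n by (cases us) auto
    thus "N v \<noteq> 0" using pos[of v] by (auto simp: N_def)
    fix w assume "w \<in> set ws"
    then obtain u where u: "u \<in> set us" "w = N u \<cdot>\<^sub>v u" by (auto simp: ws_def)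
    have "w \<bullet>c w = N u * N u * of_real (Re (u \<bullet>c u))"
      using u inner[of u u] car pos[OF u(1)] by metis
    also have "\<dots> = of_real (1 / sqrt (Re (u \<bullet>c u)) * (1 / sqrt (Re (u \<bullet>c u))) * Re (u \<bullet>c u))"
      unfolding N_def by (simp only: of_real_mult)
    also have "\<dots> = 1" using pos[OF u(1)] by (simp add: field_simps)
    finally show "w \<bullet>c w = 1" .
  qed
qed

text \<open>Split off one eigenvector and continue with the lower right block.  The change of basis has
  orthonormal columns in every step, so the product is unitary; for Hermitian \<open>A\<close> this makes \<open>B\<close>
  Hermitian as well, hence diagonal.\<close>

lemma unitary_schur:
  fixes A :: "complex mat"
  assumes "A \<in> carrier_mat n n" and "char_poly A = (\<Prod>e\<leftarrow>es. [:- e, 1:])"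
  obtains B P Q where "similar_mat_wit A B P Q" "upper_triangular B" "diag_mat B = es"
    "\<And>i j. i < n \<Longrightarrow> j < n \<Longrightarrow> Q $$ (i, j) = cnj (P $$ (j, i))"
proof -
  have "\<exists>B P Q. similar_mat_wit A B P Q \<and> upper_triangular B \<and> diag_mat B = es \<and>
    (\<forall>i<n. \<forall>j<n. Q $$ (i, j) = cnj (P $$ (j, i)))"
    using assms
  proof (induction es arbitrary: n A)
    case Nil
    with degree_monic_char_poly[of A n] have "n = 0" by auto
    thus ?case using Nil
      by (intro exI[of _ A] exI[of _ "1\<^sub>m 0"]) (auto intro: similar_mat_wit_refl simp: diag_mat_def)
  next
    case (Cons e es)
    note A = Cons.prems(1) and cp = Cons.prems(2)
    let ?n1 = "n - 1"
    have e: "eigenvalue A e" unfolding eigenvalue_root_char_poly[OF A] cp by simp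
    then obtain v0 where v0: "v0 \<in> carrier_vec n" "v0 \<noteq> 0\<^sub>v n" "A *\<^sub>v v0 = e \<cdot>\<^sub>v v0"
      using A by (auto simp: eigenvalue_def eigenvector_def)
    hence n: "n \<noteq> 0" by auto
    obtain ws c where ws: "set ws \<subseteq> carrier_vec n" "corthogonal ws" "length ws = n"
      and ws1: "\<And>w. w \<in> set ws \<Longrightarrow> w \<bullet>c w = 1" and hdws: "hd ws = c \<cdot>\<^sub>v v0" and c: "c \<noteq> 0"
      using orthonormal_basis_extending[OF v0(1,2)] by metis
    define v where "v = c \<cdot>\<^sub>v v0"
    have v: "v \<in> carrier_vec n" using v0 by (simp add: v_def)
    have "hd ws \<in> set ws" using ws(3) n by (cases ws) auto
    hence "v \<bullet>c v = 1" using ws1 hdws v_def by auto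
    hence vnz: "v \<noteq> 0\<^sub>v n" by auto
    have eigen: "A *\<^sub>v v = e \<cdot>\<^sub>v v"
      unfolding v_def using v0 A by (simp add: mult_mat_vec smult_smult_assoc mult.commute)
    define W where "W = mat_of_cols n ws"
    \<comment> \<open>For unit columns the inverse of \<open>W\<close> is its adjoint.\<close>
    define W' where "W' = corthogonal_inv W"
    have W: "W \<in> carrier_mat n n" using ws unfolding W_def by auto
    have W': "W' \<in> carrier_mat n n" unfolding W'_def corthogonal_inv_def using W
      by (auto simp: mat_of_rows_def)
    have adjW: "W' $$ (i, j) = cnj (W $$ (j, i))" if "i < n" "j < n" for i j
    proof -
      have "ws ! i \<in> set ws" using that ws by simp
      hence "vec_inv (ws ! i) = conjugate (ws ! i)" "dim_vec (ws ! i) = n"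
        using ws1[of "ws ! i"] ws(1) by (auto simp: vec_inv_def)
      thus ?thesis using that ws W
        by (simp add: W'_def W_def corthogonal_inv_def mat_of_rows_def mat_of_cols_def[symmetric]
            cols_mat_of_cols mat_of_cols_index)
    qed
    have W'W: "W' * W = 1\<^sub>m n"
      using corthogonal_inv_result[OF orthogonal_mat_of_cols[OF ws], folded W_def, folded W'_def] W'
      by (simp add: inverts_mat_def)
    hence WW': "W * W' = 1\<^sub>m n" using mat_mult_left_right_inverse[OF W' W] by simp
    define A' where "A' = W' * A * W"
    have A': "A' \<in> carrier_mat n n" using W W' A unfolding A'_def by auto
    have A'A: "similar_mat_wit A' A W' W"
      by (rule similar_mat_witI[of _ _ n], insert W W' A A' W'W WW', auto simp: A'_def)
    hence AA': "similar_mat_wit A A' W W'" by (rule similar_mat_wit_sym)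
    have col0: "col A' 0 = vec n (\<lambda>i. if i = 0 then e else 0)"
      unfolding A'_def W'_def W_def
      by (rule corthogonal_col_ev_0[OF A v vnz eigen n _ ws]) (simp add: hdws v_def)
    obtain A1 A2 A0 A3 where split: "split_block A' 1 1 = (A1,A2,A0,A3)"
      by (cases "split_block A' 1 1", auto)
    have dims: "dim_row A' = 1 + ?n1" "dim_col A' = 1 + ?n1" using A' n by auto
    from split_block[OF split dims] have A1: "A1 \<in> carrier_mat 1 1" and A2: "A2 \<in> carrier_mat 1 ?n1"
      and A0: "A0 \<in> carrier_mat ?n1 1" and A3: "A3 \<in> carrier_mat ?n1 ?n1"
      and block: "A' = four_block_mat A1 A2 A0 A3" by auto
    have ent: "A' $$ (i, 0) = (if i = 0 then e else 0)" if "i < n" for i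
      using arg_cong[OF col0, of "\<lambda>v. v $ i"] that A' by auto
    have A1id: "A1 = mat 1 1 (\<lambda>_. e)"
      using split[unfolded split_block_def Let_def] ent[of 0] n A' by auto
    have A0id: "A0 = 0\<^sub>m ?n1 1"
    proof (rule eq_matI)
      fix i j assume ij: "i < dim_row (0\<^sub>m ?n1 1)" "j < dim_col (0\<^sub>m ?n1 1 :: complex mat)"
      have "A0 = mat ?n1 1 (\<lambda>(i, j). A' $$ (i + 1, j))"
        using split[unfolded split_block_def Let_def] A' n by auto
      thus "A0 $$ (i, j) = 0\<^sub>m ?n1 1 $$ (i, j)" using ent[of "Suc i"] ij by auto
    qed (use A0 in auto)
    have "char_poly A' = [:- e, 1:] * (\<Prod>e\<leftarrow>es. [:- e, 1:])"
      using cp char_poly_similar[of A' A] A'A by (auto simp: similar_mat_def)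
    moreover have "char_poly A' = char_poly A1 * char_poly A3"
      unfolding block A0id by (rule char_poly_four_block_zeros_col[OF A1 A2 A3])
    moreover have "char_poly A1 = [:- e, 1:]"
      by (simp add: A1id char_poly_defs det_def sign_def)
    ultimately have "char_poly A3 = (\<Prod>e\<leftarrow>es. [:- e, 1:])"
      by (metis mult_cancel_left pCons_eq_0_iff zero_neq_one)
    from Cons.IH[OF A3 this] obtain B P Q where sim: "similar_mat_wit A3 B P Q"
      and ut: "upper_triangular B" and diag: "diag_mat B = es"
      and adj: "\<And>i j. i < ?n1 \<Longrightarrow> j < ?n1 \<Longrightarrow> Q $$ (i, j) = cnj (P $$ (j, i))" by blast
    from similar_mat_witD2[OF A3 sim] have B: "B \<in> carrier_mat ?n1 ?n1"
      and P: "P \<in> carrier_mat ?n1 ?n1" and Q: "Q \<in> carrier_mat ?n1 ?n1" and PQ: "P * Q = 1\<^sub>m ?n1" by auto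
    define P4 where "P4 = four_block_mat (1\<^sub>m 1) (0\<^sub>m 1 ?n1) (0\<^sub>m ?n1 1) P"
    define Q4 where "Q4 = four_block_mat (1\<^sub>m 1) (0\<^sub>m 1 ?n1) (0\<^sub>m ?n1 1) Q"
    define C where "C = four_block_mat A1 (A2 * P) A0 B"
    have car4: "P4 \<in> carrier_mat n n" "Q4 \<in> carrier_mat n n"
      using P Q n by (auto simp: P4_def Q4_def)
    have adj4: "Q4 $$ (i, j) = cnj (P4 $$ (j, i))" if "i < n" "j < n" for i j
      using that adj[of "i - 1" "j - 1"] P Q by (auto simp: P4_def Q4_def)
    have "A0 = P * A0 * 1\<^sub>m 1" unfolding A0id using P by auto
    moreover have "A2 = 1\<^sub>m 1 * (A2 * P) * Q"
      using A2 P Q PQ by (simp add: assoc_mult_mat[OF A2 P Q])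
    ultimately have "similar_mat_wit A' C P4 Q4" unfolding block C_def P4_def Q4_def
      by (intro similar_mat_wit_four_block[OF similar_mat_wit_refl[OF A1] sim _ _ A1 A3 A0]) (use A2 P in auto)
    hence simAC: "similar_mat_wit A C (W * P4) (Q4 * W')" by (rule similar_mat_wit_trans[OF AA'])
    have ut1: "upper_triangular A1" unfolding A1id by auto
    have utC: "upper_triangular C" unfolding C_def A0id
      by (intro upper_triangular_four_block[OF _ B ut1 ut], auto simp: A1id)
    have "diag_mat A1 = [e]" unfolding A1id diag_mat_def by auto
    hence diagC: "diag_mat C = e # es"
      using diag_four_block_mat[OF A1 B] diag by (simp add: C_def)
    have adjC: "(Q4 * W') $$ (i, j) = cnj ((W * P4) $$ (j, i))" if "i < n" "j < n" for i j
      using that car4 W W' adjW adj4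
      by (auto simp: scalar_prod_def mult.commute intro!: sum.cong)
    show ?case using simAC utC diagC adjC by blast
  qed
  thus thesis using that by blast
qed

section \<open>Partial sums of eigenvalues of a frame operator\<close>

text \<open>Moving weight from an index \<open>r \<ge> t\<close> to an index \<open>r < t\<close> does not decrease the sum.  This shows at
  once after subtracting the threshold \<open>\<mu> (t - 1)\<close> from all values.\<close>

lemma weighted_sum_le_leading_sum:
  fixes \<mu> w :: "nat \<Rightarrow> real"
  assumes anti: "\<And>r s. r \<le> s \<Longrightarrow> s < k \<Longrightarrow> \<mu> s \<le> \<mu> r" and nonneg: "\<And>r. r < k \<Longrightarrow> 0 \<le> \<mu> r"
    and w: "\<And>r. r < k \<Longrightarrow> 0 \<le> w r \<and> w r \<le> 1" and t: "t \<le> k" "(\<Sum>r<k. w r) \<le> real t"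
  shows "(\<Sum>r<k. \<mu> r * w r) \<le> (\<Sum>r<t. \<mu> r)"
proof (cases "t = 0")
  case True
  hence "(\<Sum>r<k. w r) = 0" using t w sum_nonneg[of "{..<k}" w] by force
  hence "w r = 0" if "r < k" for r using that w by (subst (asm) sum_nonneg_eq_0_iff) auto
  thus ?thesis using True by simp
next
  case False
  define l where "l = \<mu> (t - 1)"
  have l0: "l \<ge> 0" using nonneg[of "t - 1"] t False by (simp add: l_def)
  have summand: "(\<mu> r - l) * w r \<le> (if r < t then \<mu> r - l else 0)" if r: "r < k" for r
  proof (cases "r < t")
    case True
    hence "\<mu> r - l \<ge> 0" using anti[of r "t - 1"] t by (simp add: l_def)
    thus ?thesis using True w[OF r] mult_left_le[of "w r" "\<mu> r - l"] by simp
  next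
    case False
    hence "\<mu> r - l \<le> 0" using anti[of "t - 1" r] r by (simp add: l_def)
    thus ?thesis using False w[OF r] by (simp add: mult_nonpos_nonneg)
  qed
  have "(\<Sum>r<k. \<mu> r * w r) = (\<Sum>r<k. (\<mu> r - l) * w r) + l * (\<Sum>r<k. w r)"
    by (simp add: sum_distrib_left sum.distrib[symmetric] algebra_simps)
  also have "\<dots> \<le> (\<Sum>r<k. if r < t then \<mu> r - l else 0) + l * real t"
    using summand t(2) l0 by (intro add_mono sum_mono mult_left_mono) auto
  also have "(\<Sum>r<k. if r < t then \<mu> r - l else 0) = (\<Sum>r<t. \<mu> r - l)"
    using t(1) by (subst sum.inter_filter[symmetric]) (auto intro!: sum.cong)
  finally show ?thesis by (simp add: sum_subtractf mult.commute)
qed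

text \<open>The vectors \<open>c r / sqrt (\<mu> r)\<close>, for \<open>\<mu> r \<noteq> 0\<close>, are orthonormal in \<open>\<complex>\<^sup>I\<close>; this is Bessel's inequality
  for the standard unit vector at \<open>i\<close>.  Where \<open>\<mu> r = 0\<close> the quotient is \<open>0\<close>.\<close>

lemma bessel_coordinate:
  fixes c :: "nat \<Rightarrow> 'i \<Rightarrow> complex" and \<mu> :: "nat \<Rightarrow> real"
  assumes I: "finite I" "i \<in> I"
    and orth: "\<And>r s. r < k \<Longrightarrow> s < k \<Longrightarrow>
      (\<Sum>i\<in>I. c r i * cnj (c s i)) = (if r = s then of_real (\<mu> r) else 0)"
  shows "(\<Sum>r<k. (cmod (c r i))\<^sup>2 / \<mu> r) \<le> 1"
proof -
  define q where "q = (\<Sum>r<k. (cmod (c r i))\<^sup>2 / \<mu> r)"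
  \<comment> \<open>\<open>x\<close> is the orthogonal projection of the unit vector at \<open>i\<close>, so \<open>\<parallel>x\<parallel>\<^sup>2 = x i\<close>.\<close>
  define x where "x l = (\<Sum>r<k. cnj (c r i) / of_real (\<mu> r) * c r l)" for l
  have xi: "x i = of_real q"
    unfolding x_def q_def of_real_sum
    by (intro sum.cong refl) (simp add: complex_norm_square mult.commute del: of_real_power)
  have "of_real (\<Sum>l\<in>I. (cmod (x l))\<^sup>2) = (\<Sum>l\<in>I. x l * cnj (x l))"
    by (simp add: complex_norm_square del: of_real_power)
  also have "\<dots> = (\<Sum>l\<in>I. \<Sum>r<k. \<Sum>s<k. (cnj (c r i) / of_real (\<mu> r)) * (c s i / of_real (\<mu> s))
      * (c r l * cnj (c s l)))"
    by (simp add: x_def sum_product mult_ac)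
  also have "\<dots> = (\<Sum>r<k. \<Sum>s<k. (cnj (c r i) / of_real (\<mu> r)) * (c s i / of_real (\<mu> s))
      * (\<Sum>l\<in>I. c r l * cnj (c s l)))"
    unfolding sum_distrib_left by (subst sum.swap, intro sum.cong refl, rule sum.swap)
  also have "\<dots> = (\<Sum>r<k. \<Sum>s<k. if r = s then of_real ((cmod (c r i))\<^sup>2 / \<mu> r) else 0)"
  proof (intro sum.cong refl)
    fix r s assume "r \<in> {..<k}" "s \<in> {..<k}"
    thus "cnj (c r i) / of_real (\<mu> r) * (c s i / of_real (\<mu> s)) * (\<Sum>l\<in>I. c r l * cnj (c s l))
      = (if r = s then of_real ((cmod (c r i))\<^sup>2 / \<mu> r) else 0)"
      by (simp add: orth complex_norm_square field_simps del: of_real_power)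
  qed
  also have "\<dots> = of_real q" by (simp add: q_def sum.delta)
  finally have norm: "(\<Sum>l\<in>I. (cmod (x l))\<^sup>2) = q" by (simp only: of_real_eq_iff)
  have "q\<^sup>2 = (cmod (x i))\<^sup>2" by (simp add: xi)
  also have "\<dots> \<le> q" unfolding norm[symmetric] using I by (intro member_le_sum) auto
  finally show ?thesis unfolding q_def[symmetric]
    by (smt (verit) mult_le_cancel_left2 power2_eq_square)
qed

text \<open>The quotients \<open>w r = (\<Sum>i\<in>J. \<bar>c r i\<bar>\<^sup>2) / \<mu> r\<close> lie in \<open>[0, 1]\<close>, because \<open>\<mu> r\<close> is the same sum over
  all of \<open>I\<close>, and add up to at most \<open>card J\<close> by Bessel's inequality.  So the left-hand side is a
  weighted sum of the \<open>\<mu> r\<close> as in \<open>weighted_sum_le_leading_sum\<close>.\<close>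

lemma orthogonal_rows_partial_sum:
  fixes c :: "nat \<Rightarrow> 'i \<Rightarrow> complex" and \<mu> :: "nat \<Rightarrow> real"
  assumes I: "finite I" "J \<subseteq> I"
    and orth: "\<And>r s. r < k \<Longrightarrow> s < k \<Longrightarrow>
      (\<Sum>i\<in>I. c r i * cnj (c s i)) = (if r = s then of_real (\<mu> r) else 0)"
    and anti: "\<And>r s. r \<le> s \<Longrightarrow> s < k \<Longrightarrow> \<mu> s \<le> \<mu> r"
  shows "(\<Sum>i\<in>J. \<Sum>r<k. (cmod (c r i))\<^sup>2) \<le> (\<Sum>r<min (card J) k. \<mu> r)"
proof -
  have lam: "\<mu> r = (\<Sum>i\<in>I. (cmod (c r i))\<^sup>2)" if "r < k" for r
  proof -
    have "complex_of_real (\<mu> r) = of_real (\<Sum>i\<in>I. (cmod (c r i))\<^sup>2)"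
      using orth[OF that that] by (simp add: complex_norm_square del: of_real_power)
    thus ?thesis by (simp only: of_real_eq_iff)
  qed
  define w where "w r = (\<Sum>i\<in>J. (cmod (c r i))\<^sup>2) / \<mu> r" for r
  have part: "(\<Sum>i\<in>J. (cmod (c r i))\<^sup>2) \<le> \<mu> r" if "r < k" for r
    unfolding lam[OF that] using I by (intro sum_mono2) auto
  have nonneg: "0 \<le> (\<Sum>i\<in>J. (cmod (c r i))\<^sup>2)" for r by (intro sum_nonneg) auto
  have lw: "\<mu> r * w r = (\<Sum>i\<in>J. (cmod (c r i))\<^sup>2)" if "r < k" for r
    using part[OF that] nonneg[of r] by (auto simp: w_def)
  have lam0: "0 \<le> \<mu> r" if "r < k" for r using part[OF that] nonneg[of r] by linarith
  have w: "0 \<le> w r \<and> w r \<le> 1" if "r < k" for r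
    using part[OF that] nonneg[of r] lam0[OF that]
    by (auto simp: w_def divide_le_eq_1 intro!: divide_nonneg_nonneg)
  have "(\<Sum>r<k. w r) = (\<Sum>i\<in>J. \<Sum>r<k. (cmod (c r i))\<^sup>2 / \<mu> r)"
    unfolding w_def sum_divide_distrib by (rule sum.swap)
  also have "\<dots> \<le> (\<Sum>i\<in>J. 1)" using I bessel_coordinate[OF I(1) _ orth] by (intro sum_mono) auto
  finally have "(\<Sum>r<k. w r) \<le> real (card J)" by simp
  moreover have "(\<Sum>r<k. w r) \<le> (\<Sum>r<k. 1)" using w by (intro sum_mono) auto
  ultimately have "(\<Sum>r<k. w r) \<le> real (min (card J) k)" by simp
  hence "(\<Sum>r<k. \<mu> r * w r) \<le> (\<Sum>r<min (card J) k. \<mu> r)"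
    using anti lam0 w by (intro weighted_sum_le_leading_sum) auto
  also have "(\<Sum>r<k. \<mu> r * w r) = (\<Sum>r<k. \<Sum>i\<in>J. (cmod (c r i))\<^sup>2)" using lw by simp
  also have "\<dots> = (\<Sum>i\<in>J. \<Sum>r<k. (cmod (c r i))\<^sup>2)" by (rule sum.swap)
  finally show ?thesis .
qed

text \<open>Triangularization produces the diagonal in any prescribed order of the roots; this order makes its
  real parts the entries of \<open>spec_list A\<close>.\<close>

lemma char_poly_roots_listing:
  fixes A :: "complex mat"
  assumes A: "A \<in> carrier_mat k k"
  obtains es where "char_poly A = (\<Prod>e\<leftarrow>es. [:- e, 1:])" "map Re es = spec_list A"
proof -
  obtain as :: "complex list" where as: "char_poly A = (\<Prod>a\<leftarrow>as. [:- a, 1:])"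
    using char_poly_factorized[OF A] by blast
  have roots: "proots (\<Prod>a\<leftarrow>as. [:- a, 1:]) = mset as" for as :: "complex list"
  proof (induction as)
    case (Cons a as)
    have "(\<Prod>a\<leftarrow>as. [:- a, 1:]) \<noteq> 0" by (auto simp: prod_list_zero_iff)
    hence "proots ([:- a, 1:] * (\<Prod>a\<leftarrow>as. [:- a, 1:])) = {#a#} + mset as"
      using Cons.IH by (subst proots_mult) auto
    thus ?case by simp
  qed simp
  define es where "es = rev (sort_key Re as)"
  have "(\<Prod>e\<leftarrow>es. [:- e, 1:]) = prod_mset (image_mset (\<lambda>e. [:- e, 1:]) (mset es))"
    by (metis mset_map prod_mset_prod_list)
  also have "\<dots> = (\<Prod>e\<leftarrow>as. [:- e, 1:])"
    unfolding es_def by (simp flip: prod_mset_prod_list)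
  finally have 1: "char_poly A = (\<Prod>e\<leftarrow>es. [:- e, 1:])" using as by simp
  have "map Re (sort_key Re as) = sort (map Re as)"
    by (rule properties_for_sort[symmetric]) simp_all
  also have "\<dots> = sorted_list_of_multiset (image_mset Re (mset as))"
    unfolding mset_map[symmetric] sorted_list_of_multiset_mset by (rule refl)
  finally have "map Re (sort_key Re as) = sorted_list_of_multiset (image_mset Re (mset as))" .
  hence "rev (map Re (sort_key Re as)) = spec_list A"
    by (simp only: spec_list_def as roots)
  hence "map Re es = spec_list A" by (simp only: es_def rev_map)
  with 1 show thesis by (rule that)
qed

lemma spec_list_antimono:
  assumes "r \<le> s" "s < length (spec_list A)"
  shows "spec_list A ! s \<le> spec_list A ! r"
proof (rule sorted_rev_nth_mono[OF _ assms])
  show "sorted (rev (spec_list A))" by (simp add: spec_list_def)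
qed

lemma frame_mat_carrier: "frame_mat k n F \<in> carrier_mat k k"
  by (simp add: frame_mat_def)

lemma frame_mat_entry:
  assumes F: "\<And>i. i \<in> {1..n} \<Longrightarrow> F i \<in> carrier_vec k" and rs: "r < k" "s < k"
  shows "frame_mat k n F $$ (r, s) = (\<Sum>i=1..n. F i $ r * cnj (F i $ s))"
proof -
  have "frame_mat k n F $$ (r, s) = (\<Sum>i=1..n. ((unit_vec k s \<bullet>c F i) \<cdot>\<^sub>v F i) $ r)"
  proof -
    have "frame_operator k n F (unit_vec k s) $ r = (\<Sum>i=1..n. ((unit_vec k s \<bullet>c F i) \<cdot>\<^sub>v F i) $ r)"
      unfolding frame_operator_def using rs F by (intro index_finsum_vec) auto
    thus ?thesis using rs by (simp add: frame_mat_def)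
  qed
  also have "\<dots> = (\<Sum>i=1..n. F i $ r * cnj (F i $ s))"
  proof (intro sum.cong refl)
    fix i assume i: "i \<in> {1..n}"
    have "unit_vec k s \<bullet>c F i = cnj (F i $ s)"
      using F[OF i] rs by (subst scalar_prod_left_unit) auto
    thus "((unit_vec k s \<bullet>c F i) \<cdot>\<^sub>v F i) $ r = F i $ r * cnj (F i $ s)"
      using F[OF i] rs by auto
  qed
  finally show ?thesis .
qed

lemma cvec_norm_sq:
  assumes "v \<in> carrier_vec k"
  shows "(cvec_norm v)\<^sup>2 = (\<Sum>a<k. (cmod (v $ a))\<^sup>2)"
proof -
  have "v \<bullet>c v = of_real (\<Sum>a<k. (cmod (v $ a))\<^sup>2)"
    using assms by (auto simp: scalar_prod_def atLeast0LessThan complex_norm_square[symmetric]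
        intro!: sum.cong)
  thus ?thesis by (simp add: cvec_norm_def sum_nonneg del: of_real_sum)
qed

text \<open>Here \<open>c r i\<close> is the coefficient of \<open>F i\<close> along the \<open>r\<close>-th vector of an orthonormal eigenbasis of the
  frame operator: Parseval's identity, and the matrix of the frame operator in that basis.\<close>

lemma frame_spectral_coefficients:
  assumes F: "\<And>i. i \<in> {1..n} \<Longrightarrow> F i \<in> carrier_vec k"
  obtains c :: "nat \<Rightarrow> nat \<Rightarrow> complex" where
    "\<And>i. i \<in> {1..n} \<Longrightarrow> (\<Sum>r<k. (cmod (c r i))\<^sup>2) = (cvec_norm (F i))\<^sup>2"
    "\<And>r s. r < k \<Longrightarrow> s < k \<Longrightarrow> (\<Sum>i\<in>{1..n}. c r i * cnj (c s i)) =
       (if r = s then of_real (spec_list (frame_mat k n F) ! r) else 0)"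
proof -
  define S where "S = frame_mat k n F"
  have S: "S \<in> carrier_mat k k" by (simp add: S_def frame_mat_carrier)
  obtain es where es: "char_poly S = (\<Prod>e\<leftarrow>es. [:- e, 1:])" "map Re es = spec_list S"
    using char_poly_roots_listing[OF S] .
  obtain B P Q where sim: "similar_mat_wit S B P Q" and ut: "upper_triangular B"
    and diag: "diag_mat B = es" and adj: "\<And>i j. i < k \<Longrightarrow> j < k \<Longrightarrow> Q $$ (i, j) = cnj (P $$ (j, i))"
    using unitary_schur[OF S es(1)] by blast
  note wit = similar_mat_witD2[OF S sim]
  have B: "B \<in> carrier_mat k k" and P: "P \<in> carrier_mat k k" and Q: "Q \<in> carrier_mat k k" using wit by auto
  have BQSP: "B = Q * S * P"
    using similar_mat_witD2[OF B similar_mat_wit_sym[OF sim]] by simp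
  define c where "c r i = (\<Sum>a<k. Q $$ (r, a) * F i $ a)" for r i
  have Bent: "B $$ (r, s) = (\<Sum>i\<in>{1..n}. c r i * cnj (c s i))" if rs: "r < k" "s < k" for r s
  proof -
    have "B $$ (r, s) = (\<Sum>a<k. Q $$ (r, a) * (\<Sum>b<k. S $$ (a, b) * P $$ (b, s)))"
      unfolding BQSP using rs P Q S by (simp add: scalar_prod_def atLeast0LessThan)
    also have "\<dots> = (\<Sum>a<k. \<Sum>b<k. \<Sum>i=1..n. (Q $$ (r, a) * F i $ a) * cnj (Q $$ (s, b) * F i $ b))"
    proof (intro sum.cong refl, unfold sum_distrib_left, intro sum.cong refl)
      fix a b assume ab: "a \<in> {..<k}" "b \<in> {..<k}"
      hence "S $$ (a, b) = (\<Sum>i=1..n. F i $ a * cnj (F i $ b))" "P $$ (b, s) = cnj (Q $$ (s, b))"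
        using frame_mat_entry[of n F k a b] F adj rs by (auto simp: S_def)
      thus "Q $$ (r, a) * (S $$ (a, b) * P $$ (b, s))
          = (\<Sum>i=1..n. (Q $$ (r, a) * F i $ a) * cnj (Q $$ (s, b) * F i $ b))"
        by (simp add: sum_distrib_left sum_distrib_right mult_ac)
    qed
    also have "\<dots> = (\<Sum>a<k. \<Sum>i=1..n. \<Sum>b<k. (Q $$ (r, a) * F i $ a) * cnj (Q $$ (s, b) * F i $ b))"
      by (rule sum.cong[OF refl], rule sum.swap)
    also have "\<dots> = (\<Sum>i=1..n. \<Sum>a<k. \<Sum>b<k. (Q $$ (r, a) * F i $ a) * cnj (Q $$ (s, b) * F i $ b))"
      by (rule sum.swap)
    also have "\<dots> = (\<Sum>i=1..n. c r i * cnj (c s i))"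
      unfolding c_def cnj_sum sum_product ..
    finally show ?thesis .
  qed
  \<comment> \<open>\<open>B\<close> is the Gram matrix of the rows of \<open>c\<close>, hence Hermitian.\<close>
  have herm: "B $$ (r, s) = cnj (B $$ (s, r))" if "r < k" "s < k" for r s
    using that by (simp add: Bent mult.commute)
  have off: "B $$ (r, s) = 0" if rs: "r < k" "s < k" "r \<noteq> s" for r s
  proof (cases "s < r")
    case True
    thus ?thesis using upper_triangularD[OF ut, of s r] rs B by simp
  next
    case False
    hence "B $$ (s, r) = 0" using upper_triangularD[OF ut, of r s] rs B by simp
    thus ?thesis using herm[OF rs(1,2)] by simp
  qed
  have dg: "B $$ (r, r) = of_real (spec_list S ! r)" if r: "r < k" for r
  proof -
    have len: "r < length es" using arg_cong[OF diag, of length] r B by (simp add: diag_mat_def)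
    have "B $$ (r, r) = es ! r" using r B by (simp add: diag[symmetric] diag_mat_def)
    moreover have "Im (B $$ (r, r)) = 0"
      using arg_cong[OF herm[OF r r], of Im] by simp
    moreover have "Re (es ! r) = spec_list S ! r" using len by (simp flip: es(2))
    ultimately show ?thesis by (auto simp: complex_eq_iff)
  qed
  show thesis
  proof (rule that)
    show "(\<Sum>i\<in>{1..n}. c r i * cnj (c s i)) =
       (if r = s then of_real (spec_list (frame_mat k n F) ! r) else 0)" if "r < k" "s < k" for r s
      using that Bent[of r s] off[of r s] dg[of r] by (auto simp: S_def)
    fix i assume i: "i \<in> {1..n}"
    have PQ: "(\<Sum>r<k. P $$ (b, r) * Q $$ (r, a)) = (if b = a then 1 else 0)" if "a < k" "b < k" for a b
    proof -
      have "(P * Q) $$ (b, a) = (\<Sum>r<k. P $$ (b, r) * Q $$ (r, a))"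
        using that P Q by (simp add: scalar_prod_def atLeast0LessThan)
      thus ?thesis using wit(1) that by simp
    qed
    have "complex_of_real (\<Sum>r<k. (cmod (c r i))\<^sup>2) = (\<Sum>r<k. c r i * cnj (c r i))"
      by (simp add: complex_norm_square del: of_real_power)
    also have "\<dots> = (\<Sum>r<k. \<Sum>a<k. \<Sum>b<k. F i $ a * cnj (F i $ b) * (P $$ (b, r) * Q $$ (r, a)))"
      unfolding c_def cnj_sum sum_product by (intro sum.cong refl) (simp add: adj)
    also have "\<dots> = (\<Sum>a<k. \<Sum>b<k. F i $ a * cnj (F i $ b) * (\<Sum>r<k. P $$ (b, r) * Q $$ (r, a)))"
      unfolding sum_distrib_left by (subst sum.swap, rule sum.cong[OF refl], rule sum.swap)
    also have "\<dots> = (\<Sum>a<k. \<Sum>b<k. if b = a then F i $ a * cnj (F i $ a) else 0)"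
      by (intro sum.cong refl) (simp add: PQ)
    also have "\<dots> = of_real ((cvec_norm (F i))\<^sup>2)"
      unfolding cvec_norm_sq[OF F[OF i]]
      by (simp add: complex_norm_square sum.delta del: of_real_power)
    finally show "(\<Sum>r<k. (cmod (c r i))\<^sup>2) = (cvec_norm (F i))\<^sup>2" by (simp only: of_real_eq_iff)
  qed
qed

lemma frame_spectrum_dominates:
  assumes F: "\<And>i. i \<in> {1..n} \<Longrightarrow> F i \<in> carrier_vec k"
  defines "\<mu> \<equiv> \<lambda>r. spec_list (frame_mat k n F) ! r"
  shows "r < k \<Longrightarrow> 0 \<le> \<mu> r"
    and "J \<subseteq> {1..n} \<Longrightarrow> (\<Sum>i\<in>J. (cvec_norm (F i))\<^sup>2) \<le> (\<Sum>r<min (card J) k. \<mu> r)"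
    and "(\<Sum>i=1..n. (cvec_norm (F i))\<^sup>2) = (\<Sum>r<k. \<mu> r)"
proof -
  obtain c :: "nat \<Rightarrow> nat \<Rightarrow> complex" where
    pars: "\<And>i. i \<in> {1..n} \<Longrightarrow> (\<Sum>r<k. (cmod (c r i))\<^sup>2) = (cvec_norm (F i))\<^sup>2" and
    orth: "\<And>r s. r < k \<Longrightarrow> s < k \<Longrightarrow> (\<Sum>i\<in>{1..n}. c r i * cnj (c s i)) =
       (if r = s then of_real (\<mu> r) else 0)"
    using frame_spectral_coefficients[of n F k] F unfolding \<mu>_def by blast
  have mu: "\<mu> r = (\<Sum>i=1..n. (cmod (c r i))\<^sup>2)" if "r < k" for r
  proof -
    have "complex_of_real (\<mu> r) = of_real (\<Sum>i=1..n. (cmod (c r i))\<^sup>2)"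
      using orth[OF that that] by (simp add: complex_norm_square del: of_real_power)
    thus ?thesis by (simp only: of_real_eq_iff)
  qed
  show "r < k \<Longrightarrow> 0 \<le> \<mu> r" by (simp add: mu sum_nonneg)
  have "(\<Sum>i=1..n. (cvec_norm (F i))\<^sup>2) = (\<Sum>i=1..n. \<Sum>r<k. (cmod (c r i))\<^sup>2)"
    using pars by simp
  also have "\<dots> = (\<Sum>r<k. \<mu> r)" by (subst sum.swap) (simp add: mu)
  finally show "(\<Sum>i=1..n. (cvec_norm (F i))\<^sup>2) = (\<Sum>r<k. \<mu> r)" .
  assume J: "J \<subseteq> {1..n}"
  have "(\<Sum>i\<in>J. (cvec_norm (F i))\<^sup>2) = (\<Sum>i\<in>J. \<Sum>r<k. (cmod (c r i))\<^sup>2)"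
    using pars J by (intro sum.cong) auto
  also have "\<dots> \<le> (\<Sum>r<min (card J) k. \<mu> r)"
    using J spec_list_antimono[of _ _ "frame_mat k n F"] length_spec_list[OF frame_mat_carrier]
    by (intro orthogonal_rows_partial_sum[where I = "{1..n}"] orth) (auto simp: \<mu>_def)
  finally show "(\<Sum>i\<in>J. (cvec_norm (F i))\<^sup>2) \<le> (\<Sum>r<min (card J) k. \<mu> r)" .
qed

text \<open>Zero is not an eigenvalue, so the frame operator is surjective, and its values are combinations of
  the vectors \<open>F i\<close>.\<close>

lemma is_frame_if_spectrum_positive:
  assumes F: "\<And>i. i \<in> {1..n} \<Longrightarrow> F i \<in> carrier_vec k"
    and pos: "\<And>x. x \<in> set (spec_list (frame_mat k n F)) \<Longrightarrow> x > 0"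
  shows "is_frame k n F"
proof -
  interpret vec_space "TYPE(complex)" k .
  define S where "S = frame_mat k n F"
  have S: "S \<in> carrier_mat k k" by (simp add: S_def frame_mat_carrier)
  have "det S \<noteq> 0"
  proof
    assume "det S = 0"
    then obtain v where "v \<in> carrier_vec k" "v \<noteq> 0\<^sub>v k" "S *\<^sub>v v = 0\<^sub>v k"
      using det_0_iff_vec_prod_zero_field[OF S] by auto
    hence "eigenvalue S 0" using S by (auto simp: eigenvalue_def eigenvector_def)
    hence "poly (char_poly S) 0 = 0" using eigenvalue_root_char_poly[OF S] by simp
    moreover have "char_poly S \<noteq> 0" using degree_monic_char_poly[OF S] by auto
    ultimately have "0 \<in># proots (char_poly S)" by simp
    hence "Re 0 \<in># image_mset Re (proots (char_poly S))" unfolding set_image_mset by (rule imageI)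
    hence "0 \<in> set (spec_list S)" by (simp add: spec_list_def)
    hence "(0::real) > 0" by (intro pos) (simp add: S_def)
    thus False by simp
  qed
  from det_non_zero_imp_unit[OF S this, of "()"] obtain T where T: "T \<in> carrier_mat k k" "S * T = 1\<^sub>m k"
    unfolding Units_def ring_mat_def by auto
  have W: "F ` {1..n} \<subseteq> carrier_vec k" using F by auto
  have fin: "finsum V f A \<in> span (F ` {1..n})"
    if "finite A" "\<And>i. i \<in> A \<Longrightarrow> f i \<in> span (F ` {1..n})" for f and A :: "nat set"
    using that
  proof (induction A rule: finite_induct)
    case empty
    show ?case using W span_zero by auto
  next
    case (insert x A)
    have "finsum V f (insert x A) = f x + finsum V f A"
      using insert span_is_subset2[OF W] by (intro finsum_insert) auto
    thus ?case using insert span_add1[OF W, of "f x" "finsum V f A"] by auto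
  qed
  have "span (F ` {1..n}) = carrier_vec k"
  proof
    show "span (F ` {1..n}) \<subseteq> carrier_vec k" by (rule span_is_subset2[OF W])
    show "carrier_vec k \<subseteq> span (F ` {1..n})"
    proof
      fix v :: "complex vec" assume v: "v \<in> carrier_vec k"
      have "v = S *\<^sub>v (T *\<^sub>v v)" using v S T by (simp flip: assoc_mult_mat_vec)
      also have "\<dots> = frame_operator k n F (T *\<^sub>v v)"
        unfolding S_def using F T v by (intro frame_mat_mult_vec) auto
      also have "\<dots> \<in> span (F ` {1..n})"
        unfolding frame_operator_def finsum_vec
        using W by (intro fin smult_in_span span_mem) auto
      finally show "v \<in> span (F ` {1..n})" .
    qed
  qed
  thus ?thesis by (simp add: is_frame_def)
qed

text \<open>For \<open>t > d j\<close> the inner sum on the right is the trace of the \<open>j\<close>-th frame operator; this is why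
  the minimum is the right bound.\<close>

lemma design_spectra_dominate:
  assumes \<Phi>: "\<Phi> \<in> designs m n d \<alpha>"
  defines "L \<equiv> \<lambda>j i. spec_list (frame_mat (d j) n (\<Phi> j)) ! i"
  shows "j \<in> {1..m} \<Longrightarrow> i < d j \<Longrightarrow> 0 \<le> L j i"
    and "t \<le> n \<Longrightarrow> (\<Sum>i=1..t. \<alpha> i) \<le> (\<Sum>j=1..m. \<Sum>i<min t (d j). L j i)"
    and "(\<Sum>i=1..n. \<alpha> i) = (\<Sum>j=1..m. \<Sum>i<d j. L j i)"
proof -
  have F: "\<Phi> j i \<in> carrier_vec (d j)" if "j \<in> {1..m}" "i \<in> {1..n}" for i j
    using \<Phi> that by (auto simp: designs_def)
  have \<alpha>: "\<alpha> i = (\<Sum>j=1..m. (cvec_norm (\<Phi> j i))\<^sup>2)" if "i \<in> {1..n}" for i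
    using \<Phi> that by (auto simp: designs_def)
  have sum_\<alpha>: "(\<Sum>i=1..t. \<alpha> i) = (\<Sum>j=1..m. \<Sum>i=1..t. (cvec_norm (\<Phi> j i))\<^sup>2)" if "t \<le> n" for t
    by (subst sum.swap, intro sum.cong refl \<alpha>) (use that in auto)
  note dom = frame_spectrum_dominates[OF F]
  show "j \<in> {1..m} \<Longrightarrow> i < d j \<Longrightarrow> 0 \<le> L j i" unfolding L_def by (rule dom(1))
  show "(\<Sum>i=1..n. \<alpha> i) = (\<Sum>j=1..m. \<Sum>i<d j. L j i)"
    unfolding L_def sum_\<alpha>[OF order_refl] by (intro sum.cong refl dom(3))
  assume t: "t \<le> n"
  show "(\<Sum>i=1..t. \<alpha> i) \<le> (\<Sum>j=1..m. \<Sum>i<min t (d j). L j i)"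
    unfolding sum_\<alpha>[OF t]
  proof (rule sum_mono)
    fix j assume "j \<in> {1..m}"
    from dom(2)[OF this, where J = "{1..t}"] t
    show "(\<Sum>i=1..t. (cvec_norm (\<Phi> j i))\<^sup>2) \<le> (\<Sum>i<min t (d j). L j i)" by (simp add: L_def)
  qed
qed

section \<open>Supporting lines of convex functions\<close>

text \<open>Slopes of chords to the left of \<open>x\<close> are bounded by those to the right, so their supremum separates
  them.  The point \<open>0\<close> is excluded because there the left chords are missing and the slope may be
  \<open>-\<infinity>\<close>.\<close>

lemma supporting_line:
  fixes \<phi> :: "real \<Rightarrow> real"
  assumes \<phi>: "convex_on {0..} \<phi>" and x: "x > 0"
  obtains s where "\<And>y. y \<ge> 0 \<Longrightarrow> \<phi> y \<ge> \<phi> x + s * (y - x)"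
proof -
  define S where "S = (\<lambda>y. (\<phi> y - \<phi> x) / (y - x)) ` {0..<x}"
  define s where "s = Sup S"
  have le: "(\<phi> y - \<phi> x) / (y - x) \<le> (\<phi> z - \<phi> x) / (z - x)" if "0 \<le> y" "y < x" "x < z" for y z
  proof -
    have "(\<phi> y - \<phi> x) / (y - x) \<le> (\<phi> x - \<phi> z) / (x - z)"
      using convex_on_slope_le[OF \<phi>, of y z x] that x by simp
    also have "\<dots> = (\<phi> z - \<phi> x) / (z - x)"
      by (metis minus_diff_eq minus_divide_divide)
    finally show ?thesis .
  qed
  have ne: "S \<noteq> {}" using x by (auto simp: S_def)
  have upper: "u \<le> (\<phi> z - \<phi> x) / (z - x)" if "u \<in> S" "x < z" for u z
    using that le by (auto simp: S_def)
  have bdd: "bdd_above S" using upper[of _ "x + 1"] by (intro bdd_aboveI) auto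
  show thesis
  proof (rule that)
    fix y :: real assume y: "y \<ge> 0"
    consider "y < x" | "y = x" | "x < y" by linarith
    thus "\<phi> y \<ge> \<phi> x + s * (y - x)"
    proof cases
      case 1
      hence "(\<phi> y - \<phi> x) / (y - x) \<le> s"
        unfolding s_def using y by (intro cSup_upper bdd) (auto simp: S_def)
      thus ?thesis using 1 by (simp add: neg_divide_le_eq)
    next
      case 3
      have "s \<le> (\<phi> y - \<phi> x) / (y - x)"
        unfolding s_def using upper[OF _ 3] by (intro cSup_least ne) auto
      thus ?thesis using 3 by (simp add: pos_le_divide_eq)
    qed simp
  qed
qed

lemma strictly_convex_imp_convex:
  assumes "strictly_convex_on S \<phi>"
  shows "convex_on S \<phi>"
  unfolding convex_on_def
proof (intro conjI ballI allI impI)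
  show "convex S" using assms by (simp add: strictly_convex_on_def)
  fix x y and u v :: real assume *: "x \<in> S" "y \<in> S" "0 \<le> u" "0 \<le> v" "u + v = 1"
  consider "x = y" | "u = 0" | "v = 0" | "x \<noteq> y" "u > 0" "v > 0" using * by linarith
  thus "\<phi> (u *\<^sub>R x + v *\<^sub>R y) \<le> u * \<phi> x + v * \<phi> y"
  proof cases
    case 1
    thus ?thesis using * by (simp add: scaleR_add_left[symmetric] distrib_right[symmetric])
  next
    case 4
    thus ?thesis using assms * by (auto simp: strictly_convex_on_def intro!: less_imp_le)
  qed (use * in auto)
qed

text \<open>Otherwise the graph at the midpoint would lie strictly below the line.\<close>

lemma supporting_line_strict:
  fixes \<phi> :: "real \<Rightarrow> real"
  assumes \<phi>: "strictly_convex_on {0..} \<phi>" and xy: "x \<ge> 0" "y \<ge> 0"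
    and line: "\<And>y. y \<ge> 0 \<Longrightarrow> \<phi> y \<ge> \<phi> x + s * (y - x)"
    and eq: "\<phi> y = \<phi> x + s * (y - x)"
  shows "y = x"
proof (rule ccontr)
  assume "y \<noteq> x"
  hence "\<phi> ((1/2) *\<^sub>R x + (1/2) *\<^sub>R y) < (1/2) * \<phi> x + (1/2) * \<phi> y"
    using \<phi>[unfolded strictly_convex_on_def, THEN conjunct2, rule_format, of x y "1/2" "1/2"] xy
    by simp
  moreover have "\<phi> ((x + y) / 2) \<ge> \<phi> x + s * ((x + y) / 2 - x)" using xy by (intro line) simp
  ultimately show False using eq by (simp add: field_simps)
qed

lemma supporting_slopes_mono:
  fixes \<phi> :: "real \<Rightarrow> real"
  assumes "x < y" "\<phi> y \<ge> \<phi> x + s * (y - x)" "\<phi> x \<ge> \<phi> y + s' * (x - y)"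
  shows "s \<le> s'"
proof -
  have "s * (y - x) \<le> s' * (y - x)" using assms(2,3) by (simp add: algebra_simps)
  thus ?thesis using assms(1) by simp
qed

section \<open>The optimal spectra and summation by blocks\<close>

lemma sum_split_at:
  fixes f :: "nat \<Rightarrow> 'a::comm_monoid_add"
  assumes "a \<le> b"
  shows "(\<Sum>i=1..b. f i) = (\<Sum>i=1..a. f i) + (\<Sum>i=a + 1..b. f i)"
proof -
  have "{1..b} = {1..a} \<union> {a + 1..b}" using assms by auto
  thus ?thesis by (simp add: sum.union_disjoint)
qed

text \<open>Abel summation over the blocks \<open>{g (k - 1) + 1..g k}\<close>, on which the factors \<open>\<sigma> i\<close> have the constant
  value \<open>s k\<close>.  Partial sums of \<open>x\<close> need a sign only where \<open>\<sigma>\<close> changes.\<close>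

lemma block_abel_nonneg:
  fixes x :: "nat \<Rightarrow> real" and s :: "nat \<Rightarrow> real" and g :: "nat \<Rightarrow> nat"
  assumes g0: "g 0 = 0" and g: "\<And>k. k < p \<Longrightarrow> g k \<le> g (Suc k)"
    and s: "\<And>k. 1 \<le> k \<Longrightarrow> k < p \<Longrightarrow> s (Suc k) \<le> s k"
    and pos: "\<And>k. 1 \<le> k \<Longrightarrow> k < p \<Longrightarrow> 0 \<le> (\<Sum>i=1..g k. x i)" and total: "(\<Sum>i=1..g p. x i) = 0"
    and \<sigma>: "\<And>k i. 1 \<le> k \<Longrightarrow> k \<le> p \<Longrightarrow> g (k - 1) < i \<Longrightarrow> i \<le> g k \<Longrightarrow> \<sigma> i = s k"
    and p: "p \<ge> 1"
  shows "0 \<le> (\<Sum>i=1..g p. \<sigma> i * x i)"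
proof -
  \<comment> \<open>At \<open>q = p\<close> the left-hand side is 0.\<close>
  have "s q * (\<Sum>i=1..g q. x i) \<le> (\<Sum>i=1..g q. \<sigma> i * x i)" if "1 \<le> q" "q \<le> p" for q
    using that
  proof (induction q rule: nat_induct_at_least)
    case base
    have "(\<Sum>i=1..g 1. \<sigma> i * x i) = (\<Sum>i=1..g 1. s 1 * x i)"
      using \<sigma>[of 1] base g0 by (intro sum.cong) auto
    thus ?case by (simp add: sum_distrib_left)
  next
    case (Suc q)
    have "g q \<le> g (Suc q)" using g[of q] Suc.prems by simp
    note split = sum_split_at[OF this]
    have block: "(\<Sum>i=g q + 1..g (Suc q). \<sigma> i * x i) = s (Suc q) * (\<Sum>i=g q + 1..g (Suc q). x i)"
      unfolding sum_distrib_left using \<sigma>[of "Suc q"] Suc.prems by (intro sum.cong) auto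
    have "s (Suc q) * (\<Sum>i=1..g q. x i) \<le> s q * (\<Sum>i=1..g q. x i)"
      using Suc s[of q] pos[of q] by (intro mult_right_mono) auto
    also have "\<dots> \<le> (\<Sum>i=1..g q. \<sigma> i * x i)" using Suc by simp
    finally show ?case unfolding split block by (simp add: distrib_left)
  qed
  from this[of p] show ?thesis using p total by simp
qed

text \<open>The pairs \<open>(i, j)\<close> with \<open>i \<le> d j\<close>, counted by rows and by columns.  The shift accounts for eigenvalue
  lists indexed from 0.\<close>

lemma sum_layers:
  fixes G :: "nat \<Rightarrow> nat \<Rightarrow> real"
  shows "(\<Sum>i=1..t. \<Sum>j\<in>{j\<in>{1..m}. d j \<ge> i}. G j i) = (\<Sum>j=1..m. \<Sum>i<min t (d j). G j (Suc i))"
proof -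
  have "(\<Sum>i=1..t. \<Sum>j\<in>{j\<in>{1..m}. d j \<ge> i}. G j i) = (\<Sum>i=1..t. \<Sum>j=1..m. if i \<le> d j then G j i else 0)"
    by (intro sum.cong refl sum.inter_filter) auto
  also have "\<dots> = (\<Sum>j=1..m. \<Sum>i=1..t. if i \<le> d j then G j i else 0)" by (rule sum.swap)
  also have "\<dots> = (\<Sum>j=1..m. \<Sum>i<min t (d j). G j (Suc i))"
  proof (rule sum.cong[OF refl])
    fix j
    have "(\<Sum>i=1..t. if i \<le> d j then G j i else 0) = (\<Sum>i\<in>{i\<in>{1..t}. i \<le> d j}. G j i)"
      by (intro sum.inter_filter[symmetric]) auto
    also have "\<dots> = (\<Sum>i\<in>Suc ` {..<min t (d j)}. G j i)"
    proof (rule sum.cong)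
      show "{i\<in>{1..t}. i \<le> d j} = Suc ` {..<min t (d j)}"
        by (simp only: image_Suc_lessThan) auto
    qed (rule refl)
    also have "\<dots> = (\<Sum>i<min t (d j). G j (Suc i))"
      by (simp only: sum.reindex[OF inj_Suc] comp_def)
    finally show "(\<Sum>i=1..t. if i \<le> d j then G j i else 0) = (\<Sum>i<min t (d j). G j (Suc i))" .
  qed
  finally show ?thesis .
qed

lemma block_of_index:
  assumes adm: "admissible_cuts m n d \<alpha> p g" and i: "1 \<le> i" "i \<le> d 1"
  obtains k where "k \<in> {1..p}" "g (k - 1) < i" "i \<le> g k"
proof -
  define k where "k = (LEAST k. i \<le> g k)"
  have ip: "i \<le> g p" using adm i by (simp add: admissible_cuts_def)
  have k: "i \<le> g k" unfolding k_def using ip by (rule LeastI)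
  have "k \<le> p" unfolding k_def using ip by (rule Least_le)
  moreover have "k \<noteq> 0" using k adm i by (auto simp: admissible_cuts_def intro: ccontr)
  moreover have "g (k - 1) < i"
    using not_less_Least[of "k - 1" "\<lambda>k. i \<le> g k"] \<open>k \<noteq> 0\<close> by (simp add: k_def)
  ultimately show thesis using that[of k] k by simp
qed

lemma gamma_op_mono:
  assumes adm: "admissible_cuts m n d \<alpha> p g" and "1 \<le> k" "k < l" "l \<le> p"
  shows "gamma_op m n d \<alpha> p g l < gamma_op m n d \<alpha> p g k"
proof -
  have "strict_antimono_on {1..p} (gamma_op m n d \<alpha> p g)"
    using adm unfolding admissible_cuts_def by blast
  from monotone_onD[OF this, of k l] show ?thesis using assms by simp
qed

lemma mu_entry_pos:
  assumes adm: "admissible_cuts m n d \<alpha> p g" and i: "1 \<le> i" "i \<le> d 1"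
  shows "mu_entry m n d \<alpha> p g i > 0"
proof -
  obtain k where k: "k \<in> {1..p}" "g (k - 1) < i" "i \<le> g k" using block_of_index[OF adm i] .
  have "gamma_op m n d \<alpha> p g p > 0" using adm by (simp add: admissible_cuts_def)
  hence "gamma_op m n d \<alpha> p g k > 0"
    using gamma_op_mono[OF adm, of k p] k by (cases "k = p") auto
  thus ?thesis using mu_entry_eq[OF adm k(1)] k by simp
qed

text \<open>On a block \<open>\<mu>\<close> is the quotient of the sums of \<open>\<alpha>\<close> and of \<open>h\<close>.  The last block collects all of
  \<open>\<alpha>\<close> up to \<open>n\<close>, which may exceed \<open>d 1\<close>.\<close>

lemma mu_entry_partial_sums:
  assumes adm: "admissible_cuts m n d \<alpha> p g" and m: "m \<ge> 1" and dn: "d 1 \<le> n"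
  shows "q < p \<Longrightarrow> (\<Sum>i=1..g q. real (h_seq m d i) * mu_entry m n d \<alpha> p g i) = (\<Sum>i=1..g q. \<alpha> i)"
    and "(\<Sum>i=1..d 1. real (h_seq m d i) * mu_entry m n d \<alpha> p g i) = (\<Sum>i=1..n. \<alpha> i)"
proof -
  let ?h = "\<lambda>i. real (h_seq m d i)" and ?mu = "mu_entry m n d \<alpha> p g"
  let ?\<gamma> = "gamma_op m n d \<alpha> p g"
  have g: "g 0 = 0" "g p = d 1" "p \<ge> 1" using adm by (auto simp: admissible_cuts_def)
  have lt: "g k < g l" if "k < l" "l \<le> p" for k l
    using adm that by (auto simp: admissible_cuts_def monotone_on_def)
  have hpos: "?h i > 0" if "i \<le> d 1" for i
    using that m unfolding h_seq_def by (auto simp: card_gt_0_iff intro!: exI[of _ 1])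
  have le: "g k \<le> d 1" if "k \<le> p" for k using lt[of k p] that g by (cases "k = p") auto
  have hsum: "(\<Sum>i=g (k - 1) + 1..g k. ?h i) > 0" if "1 \<le> k" "k \<le> p" for k
    using that le[of k] lt[of "k - 1" k] by (intro sum_pos hpos) auto
  have block: "(\<Sum>i=g (k - 1) + 1..g k. ?h i * ?mu i) = ?\<gamma> k * (\<Sum>i=g (k - 1) + 1..g k. ?h i)"
    if "1 \<le> k" "k \<le> p" for k
    unfolding sum_distrib_left using that
    by (intro sum.cong refl) (simp add: mu_entry_eq[OF adm, of k] mult.commute)
  show part: "(\<Sum>i=1..g q. ?h i * ?mu i) = (\<Sum>i=1..g q. \<alpha> i)" if "q < p" for q
    using that
  proof (induction q)
    case (Suc q)
    have "g q \<le> g (Suc q)" using lt[of q "Suc q"] Suc.prems by simp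
    note split = sum_split_at[OF this]
    have "?\<gamma> (Suc q) * (\<Sum>i=g q + 1..g (Suc q). ?h i) = (\<Sum>i=g q + 1..g (Suc q). \<alpha> i)"
      using hsum[of "Suc q"] Suc.prems by (simp add: gamma_op_def P_avg_def)
    thus ?case unfolding split using block[of "Suc q"] Suc by simp
  qed (simp add: g)
  have le1: "g (p - 1) \<le> g p" using lt[of "p - 1" p] g by simp
  have "?\<gamma> p * (\<Sum>i=g (p - 1) + 1..g p. ?h i) = (\<Sum>i=g (p - 1) + 1..n. \<alpha> i)"
    using hsum[of p] g by (simp add: gamma_op_def Q_avg_def)
  thus "(\<Sum>i=1..d 1. ?h i * ?mu i) = (\<Sum>i=1..n. \<alpha> i)"
    using sum_split_at[OF le1, of "\<lambda>i. ?h i * ?mu i"] sum_split_at[of "g (p - 1)" n \<alpha>]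
      block[of p] part[of "p - 1"] g le1 dn by simp
qed

text \<open>The linear part of the comparison of a spectrum \<open>L\<close> with the optimal one, for slopes that increase
  with the value of \<open>\<mu>\<close> and hence decrease along the blocks.\<close>

lemma first_order_term_nonneg:
  fixes L :: "nat \<Rightarrow> nat \<Rightarrow> real"
  assumes adm: "admissible_cuts m n d \<alpha> p g" and m: "m \<ge> 1" and dn: "d 1 \<le> n"
    and d: "\<And>j. j \<in> {1..m} \<Longrightarrow> d j \<le> d 1"
    and part: "\<And>t. t \<le> n \<Longrightarrow> (\<Sum>i=1..t. \<alpha> i) \<le> (\<Sum>j=1..m. \<Sum>i<min t (d j). L j i)"
    and total: "(\<Sum>i=1..n. \<alpha> i) = (\<Sum>j=1..m. \<Sum>i<d j. L j i)"
    and \<sigma>: "\<And>x y. 0 < x \<Longrightarrow> x < y \<Longrightarrow> \<sigma> x \<le> \<sigma> y"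
  defines "\<mu> \<equiv> mu_entry m n d \<alpha> p g"
  shows "0 \<le> (\<Sum>j=1..m. \<Sum>i<d j. \<sigma> (\<mu> (Suc i)) * (L j i - \<mu> (Suc i)))"
proof -
  let ?J = "\<lambda>i. {j\<in>{1..m}. d j \<ge> i}"
  define x where "x i = (\<Sum>j\<in>?J i. L j (i - 1) - \<mu> i)" for i
  have g: "g 0 = 0" "g p = d 1" "p \<ge> 1" using adm by (auto simp: admissible_cuts_def)
  have lt: "g k < g l" if "k < l" "l \<le> p" for k l
    using adm that by (auto simp: admissible_cuts_def monotone_on_def)
  have le: "g k \<le> d 1" if "k \<le> p" for k using lt[of k p] that g by (cases "k = p") auto
  have x_sum: "(\<Sum>i=1..t. x i) =
      (\<Sum>j=1..m. \<Sum>i<min t (d j). L j i) - (\<Sum>i=1..t. real (h_seq m d i) * \<mu> i)" for t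
  proof -
    have "(\<Sum>i=1..t. x i) = (\<Sum>i=1..t. (\<Sum>j\<in>?J i. L j (i - 1)) - real (h_seq m d i) * \<mu> i)"
      by (simp add: x_def sum_subtractf h_seq_def)
    also have "\<dots> = (\<Sum>i=1..t. \<Sum>j\<in>?J i. L j (i - 1)) - (\<Sum>i=1..t. real (h_seq m d i) * \<mu> i)"
      by (rule sum_subtractf)
    finally show ?thesis using sum_layers[where t = t and m = m and d = d and G = "\<lambda>j i. L j (i - 1)"] by simp
  qed
  have min_d: "min (d 1) (d j) = d j" if "j \<in> {1..m}" for j using d[OF that] by simp
  have "0 \<le> (\<Sum>i=1..g p. \<sigma> (\<mu> i) * x i)"
  proof (rule block_abel_nonneg[where g = g and p = p and x = x and \<sigma> = "\<lambda>i. \<sigma> (\<mu> i)"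
        and s = "\<lambda>k. \<sigma> (gamma_op m n d \<alpha> p g k)"])
    show "g k \<le> g (Suc k)" if "k < p" for k using lt[of k "Suc k"] that by simp
    show "\<sigma> (gamma_op m n d \<alpha> p g (Suc k)) \<le> \<sigma> (gamma_op m n d \<alpha> p g k)" if "1 \<le> k" "k < p" for k
    proof (rule \<sigma>)
      have "gamma_op m n d \<alpha> p g p > 0" using adm by (simp add: admissible_cuts_def)
      thus "0 < gamma_op m n d \<alpha> p g (Suc k)"
        using gamma_op_mono[OF adm, of "Suc k" p] that by (cases "Suc k = p") auto
    qed (rule gamma_op_mono[OF adm], use that in auto)
    show "0 \<le> (\<Sum>i=1..g k. x i)" if "1 \<le> k" "k < p" for k
      unfolding x_sum \<mu>_def mu_entry_partial_sums(1)[OF adm m dn that(2)]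
      using part[of "g k"] le[of k] that dn by simp
    show "(\<Sum>i=1..g p. x i) = 0"
      unfolding x_sum \<mu>_def g(2) mu_entry_partial_sums(2)[OF adm m dn] total
      using min_d by (simp add: sum_subtractf)
    show "\<sigma> (\<mu> i) = \<sigma> (gamma_op m n d \<alpha> p g k)" if "1 \<le> k" "k \<le> p" "g (k - 1) < i" "i \<le> g k" for k i
      using that mu_entry_eq[OF adm, of k i] by (simp add: \<mu>_def)
  qed (use g in auto)
  also have "(\<Sum>i=1..g p. \<sigma> (\<mu> i) * x i) =
      (\<Sum>i=1..d 1. \<Sum>j\<in>?J i. \<sigma> (\<mu> i) * (L j (i - 1) - \<mu> i))"
    by (simp add: x_def sum_distrib_left g)
  also have "\<dots> = (\<Sum>j=1..m. \<Sum>i<min (d 1) (d j). \<sigma> (\<mu> (Suc i)) * (L j i - \<mu> (Suc i)))"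
    using sum_layers[where t = "d 1" and m = m and d = d and
      G = "\<lambda>j i. \<sigma> (\<mu> i) * (L j (i - 1) - \<mu> i)"] by simp
  also have "\<dots> = (\<Sum>j=1..m. \<Sum>i<d j. \<sigma> (\<mu> (Suc i)) * (L j i - \<mu> (Suc i)))"
    using min_d by (intro sum.cong) auto
  finally show ?thesis .
qed

section \<open>Minimizers of the joint potential\<close>

text \<open>The potential is the optimal value plus the first order term plus the distances of the graph of
  \<open>\<phi>\<close> from its supporting lines, and both corrections are nonnegative.  When the potential does not
  exceed the optimal value, all distances vanish.\<close>

lemma joint_potential_lower_bound:
  assumes adm: "admissible_cuts m n d \<alpha> p g" and m: "m \<ge> 1" and dn: "d 1 \<le> n"
    and d: "\<And>j. j \<in> {1..m} \<Longrightarrow> d j \<le> d 1"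
    and \<Phi>: "\<Phi> \<in> designs m n d \<alpha>" and \<phi>: "convex_on {0..} \<phi>"
  defines "\<mu> \<equiv> mu_entry m n d \<alpha> p g"
    and "L \<equiv> \<lambda>j i. spec_list (frame_mat (d j) n (\<Phi> j)) ! i"
  shows "(\<Sum>j=1..m. \<Sum>i<d j. \<phi> (\<mu> (Suc i))) \<le> joint_potential m n d \<phi> \<Phi>"
    and "strictly_convex_on {0..} \<phi> \<Longrightarrow>
      joint_potential m n d \<phi> \<Phi> \<le> (\<Sum>j=1..m. \<Sum>i<d j. \<phi> (\<mu> (Suc i))) \<Longrightarrow>
      j \<in> {1..m} \<Longrightarrow> i < d j \<Longrightarrow> L j i = \<mu> (Suc i)"
proof -
  have dom: "\<And>j i. j \<in> {1..m} \<Longrightarrow> i < d j \<Longrightarrow> 0 \<le> L j i"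
    "\<And>t. t \<le> n \<Longrightarrow> (\<Sum>i=1..t. \<alpha> i) \<le> (\<Sum>j=1..m. \<Sum>i<min t (d j). L j i)"
    "(\<Sum>i=1..n. \<alpha> i) = (\<Sum>j=1..m. \<Sum>i<d j. L j i)"
    using design_spectra_dominate[OF \<Phi>] unfolding L_def by blast+
  define \<sigma> where "\<sigma> x = (SOME s. \<forall>y\<ge>0. \<phi> y \<ge> \<phi> x + s * (y - x))" for x
  have \<sigma>: "\<phi> y \<ge> \<phi> x + \<sigma> x * (y - x)" if "x > 0" "y \<ge> 0" for x y
  proof -
    have "\<exists>s. \<forall>y\<ge>0. \<phi> y \<ge> \<phi> x + s * (y - x)" by (rule supporting_line[OF \<phi> that(1)]) blast
    from someI_ex[OF this] show ?thesis using that unfolding \<sigma>_def by blast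
  qed
  have mono: "\<sigma> x \<le> \<sigma> y" if "0 < x" "x < y" for x y
    by (rule supporting_slopes_mono[OF that(2) \<sigma>[of x y] \<sigma>[of y x]]) (use that in auto)
  define gap where "gap j i = \<phi> (L j i) - \<phi> (\<mu> (Suc i)) - \<sigma> (\<mu> (Suc i)) * (L j i - \<mu> (Suc i))" for j i
  have mu_pos: "\<mu> (Suc i) > 0" if "j \<in> {1..m}" "i < d j" for i j
    using mu_entry_pos[OF adm, of "Suc i"] d[OF that(1)] that by (simp add: \<mu>_def)
  have gap: "0 \<le> gap j i" if "j \<in> {1..m}" "i < d j" for i j
    using \<sigma>[OF mu_pos[OF that] dom(1)[OF that]] by (simp add: gap_def)
  have first: "0 \<le> (\<Sum>j=1..m. \<Sum>i<d j. \<sigma> (\<mu> (Suc i)) * (L j i - \<mu> (Suc i)))"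
    unfolding \<mu>_def by (rule first_order_term_nonneg[OF adm m dn d dom(2,3) mono])
  have pot: "joint_potential m n d \<phi> \<Phi> = (\<Sum>j=1..m. \<Sum>i<d j. \<phi> (\<mu> (Suc i)))
      + (\<Sum>j=1..m. \<Sum>i<d j. \<sigma> (\<mu> (Suc i)) * (L j i - \<mu> (Suc i))) + (\<Sum>j=1..m. \<Sum>i<d j. gap j i)"
  proof -
    have "joint_potential m n d \<phi> \<Phi> = (\<Sum>j=1..m. \<Sum>i<d j. \<phi> (L j i))"
      by (simp only: joint_potential_def L_def)
    also have "\<dots> = (\<Sum>j=1..m. \<Sum>i<d j.
        \<phi> (\<mu> (Suc i)) + \<sigma> (\<mu> (Suc i)) * (L j i - \<mu> (Suc i)) + gap j i)"
      by (intro sum.cong refl) (simp add: gap_def)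
    finally show ?thesis by (simp only: sum.distrib)
  qed
  have gap_sum: "0 \<le> (\<Sum>i<d j. gap j i)" if "j \<in> {1..m}" for j
    using gap[OF that] by (intro sum_nonneg) auto
  hence gaps: "0 \<le> (\<Sum>j=1..m. \<Sum>i<d j. gap j i)" by (rule sum_nonneg)
  show "(\<Sum>j=1..m. \<Sum>i<d j. \<phi> (\<mu> (Suc i))) \<le> joint_potential m n d \<phi> \<Phi>"
    using pot first gaps by linarith
  assume strict: "strictly_convex_on {0..} \<phi>" and j: "j \<in> {1..m}" and i: "i < d j"
    and "joint_potential m n d \<phi> \<Phi> \<le> (\<Sum>j=1..m. \<Sum>i<d j. \<phi> (\<mu> (Suc i)))"
  hence "(\<Sum>j=1..m. \<Sum>i<d j. gap j i) = 0" using pot first gaps by linarith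
  hence "(\<Sum>i<d j. gap j i) = 0" using gap_sum j by (subst (asm) sum_nonneg_eq_0_iff) auto
  hence "gap j i = 0" using gap[OF j] i by (subst (asm) sum_nonneg_eq_0_iff) auto
  hence "\<phi> (L j i) = \<phi> (\<mu> (Suc i)) + \<sigma> (\<mu> (Suc i)) * (L j i - \<mu> (Suc i))" by (simp add: gap_def)
  thus "L j i = \<mu> (Suc i)"
    using supporting_line_strict[OF strict less_imp_le[OF mu_pos[OF j i]] dom(1)[OF j i],
        of "\<sigma> (\<mu> (Suc i))"] \<sigma>[OF mu_pos[OF j i]] by blast
qed

theorem theorem3p15:
  fixes m n p :: nat and d g :: "nat \<Rightarrow> nat" and \<alpha> :: "nat \<Rightarrow> real"
    and \<Phi>op :: "nat \<Rightarrow> nat \<Rightarrow> complex vec"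
  assumes "m \<ge> 1" and "n \<ge> 1"
    and "\<forall>j\<in>{1..m}. d j \<ge> 1" and "antimono_on {1..m} d"
    and "\<forall>i\<in>{1..n}. \<alpha> i > 0" and "antimono_on {1..n} \<alpha>"
    and "d 1 \<le> n"
    and "admissible_cuts m n d \<alpha> p g"
    and "\<Phi>op \<in> designs m n d \<alpha>"
    and "M_design m n d \<Phi>op = M_op m n d \<alpha> p g"
  shows
    "(\<forall>\<phi>. convex_on {0..} \<phi> \<and> \<phi> ` {0..} \<subseteq> {0..} \<longrightarrow>
        (\<forall>\<Phi>\<in>designs m n d \<alpha>. joint_potential m n d \<phi> \<Phi>op \<le> joint_potential m n d \<phi> \<Phi>)) \<and>
     (\<forall>\<Phi>\<in>designs m n d \<alpha>.
        (\<exists>\<phi>. strictly_convex_on {0..} \<phi> \<and> \<phi> ` {0..} \<subseteq> {0..} \<and>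
          (\<forall>\<Psi>\<in>designs m n d \<alpha>. joint_potential m n d \<phi> \<Phi> \<le> joint_potential m n d \<phi> \<Psi>)) \<longrightarrow>
        Lambda_design m n d \<Phi> = Lambda_design m n d \<Phi>op \<and>
        M_design m n d \<Phi> = M_op m n d \<alpha> p g \<and>
        (\<forall>j\<in>{1..m}.
          spec_list (frame_mat (d j) n (\<Phi> j)) = mu_op m n d \<alpha> p g j \<and>
          length (mu_op m n d \<alpha> p g j) = d j \<and> (\<forall>x\<in>set (mu_op m n d \<alpha> p g j). x > 0) \<and>
          is_frame (d j) n (\<Phi> j)))"
proof -
  note m = assms(1) and adm = assms(8)
  let ?mu = "mu_entry m n d \<alpha> p g"
  have d: "d j \<le> d 1" if "j \<in> {1..m}" for j
    using assms(4) that m by (auto simp: monotone_on_def)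
  note bound = joint_potential_lower_bound[OF adm m assms(7) d]
  have spec_eq: "M_design m n d \<Phi> = M_op m n d \<alpha> p g \<longleftrightarrow>
      (\<forall>j\<in>{1..m}. spec_list (frame_mat (d j) n (\<Phi> j)) = mu_op m n d \<alpha> p g j)" for \<Phi>
    unfolding M_design_def M_op_def by (auto simp: less_Suc_eq_le)
  have mu_op: "length (mu_op m n d \<alpha> p g j) = d j"
    "i < d j \<Longrightarrow> mu_op m n d \<alpha> p g j ! i = ?mu (Suc i)" for i j
    by (auto simp: mu_op_def simp del: upt_Suc)
  have pot_op: "joint_potential m n d \<phi> \<Phi>op = (\<Sum>j=1..m. \<Sum>i<d j. \<phi> (?mu (Suc i)))" for \<phi>
    unfolding joint_potential_def using assms(10) spec_eq[of \<Phi>op] mu_op(2)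
    by (intro sum.cong refl) auto
  have part2: "Lambda_design m n d \<Phi> = Lambda_design m n d \<Phi>op \<and>
        M_design m n d \<Phi> = M_op m n d \<alpha> p g \<and>
        (\<forall>j\<in>{1..m}.
          spec_list (frame_mat (d j) n (\<Phi> j)) = mu_op m n d \<alpha> p g j \<and>
          length (mu_op m n d \<alpha> p g j) = d j \<and> (\<forall>x\<in>set (mu_op m n d \<alpha> p g j). x > 0) \<and>
          is_frame (d j) n (\<Phi> j))"
    if \<Phi>: "\<Phi> \<in> designs m n d \<alpha>" and \<phi>: "strictly_convex_on {0..} \<phi>"
      and min: "\<forall>\<Psi>\<in>designs m n d \<alpha>. joint_potential m n d \<phi> \<Phi> \<le> joint_potential m n d \<phi> \<Psi>" for \<Phi> \<phi>
  proof -
    have "joint_potential m n d \<phi> \<Phi> \<le> (\<Sum>j=1..m. \<Sum>i<d j. \<phi> (?mu (Suc i)))"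
      using min assms(9) pot_op by metis
    note ent = bound(2)[OF _ \<Phi> strictly_convex_imp_convex[OF \<phi>] \<phi> this]
    have spec: "spec_list (frame_mat (d j) n (\<Phi> j)) = mu_op m n d \<alpha> p g j" if j: "j \<in> {1..m}" for j
      using length_spec_list[OF frame_mat_carrier] ent[OF _ j] mu_op
      by (intro nth_equalityI) auto
    have pos: "x > 0" if j: "j \<in> {1..m}" and x: "x \<in> set (mu_op m n d \<alpha> p g j)" for j x
    proof -
      obtain i where "i < d j" "x = ?mu (Suc i)" using x mu_op by (metis in_set_conv_nth)
      thus ?thesis using mu_entry_pos[OF adm, of "Suc i"] d[OF j] by simp
    qed
    have "is_frame (d j) n (\<Phi> j)" if j: "j \<in> {1..m}" for j
      using \<Phi> j pos[OF j] spec[OF j]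
      by (intro is_frame_if_spectrum_positive) (auto simp: designs_def)
    moreover have "M_design m n d \<Phi> = M_op m n d \<alpha> p g" using spec spec_eq by blast
    ultimately show ?thesis using spec pos mu_op(1) assms(10) by (simp add: Lambda_design_def)
  qed
  show ?thesis
  proof (intro conjI allI impI ballI)
    fix \<phi> :: "real \<Rightarrow> real" and \<Phi>
    assume "convex_on {0..} \<phi> \<and> \<phi> ` {0..} \<subseteq> {0..}" "\<Phi> \<in> designs m n d \<alpha>"
    thus "joint_potential m n d \<phi> \<Phi>op \<le> joint_potential m n d \<phi> \<Phi>"
      unfolding pot_op using bound(1) by blast
  qed (use part2 in blast)+
qed

end
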